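(* Let $G$ be a connected $K_4$-minor-free graph with maximum degree at most $4$ that is not isomorphic to the $5$-cycle $C_5$. Then $G$ is proper conflict-free (degree+$2$)-choosable.
   Context: All graphs are simple and finite. A proper conflict-free coloring of a graph $G$ is a proper vertex coloring $\phi$ such that for every non-isolated vertex $v$ some color appears exactly once on the open neighborhood $N(v)$. For a non-negative integer $k$, $G$ is proper conflict-free (degree+$k$)-choosable if for every list assignment $L$ of $G$ with $|L(v)| = d_G(v)+k$ for all $v\in V(G)$, there is a proper conflict-free coloring $\phi$ of $G$ with $\phi(v)\in L(v)$ for all $v\in V(G)$. *)

theory Defs
  imports "Graph_Theory.Graph_Theory"
begin

text \<open>
  A finite simple graph is a \<^locale>\<open>pair_graph\<close>: a finite vertex set with an irreflexive
  symmetric arc relation, so that every undirected edge is present as two opposite arcs and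
  \<^const>\<open>out_degree\<close> is the usual degree. Note that \<^const>\<open>connected\<close> includes
  having at least one vertex.
\<close>

definition neighborhood :: "'a pair_pre_digraph \<Rightarrow> 'a \<Rightarrow> 'a set" where
  "neighborhood G v = {u. (v, u) \<in> parcs G}"

abbreviation degree :: "'a pair_pre_digraph \<Rightarrow> 'a \<Rightarrow> nat" where
  "degree G v \<equiv> out_degree (with_proj G) v"

lemma degree_eq_card_neighborhood: "degree G v = card (neighborhood G v)"
proof -
  have "out_arcs (with_proj G) v = Pair v ` neighborhood G v"
    by (auto simp: out_arcs_def neighborhood_def)
  then show ?thesis
    by (simp add: out_degree_def card_image inj_on_def)
qed

definition max_degree :: "'a pair_pre_digraph \<Rightarrow> nat" where
  "max_degree G = Max (degree G ` pverts G)"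

definition complete_graph :: "nat \<Rightarrow> nat pair_pre_digraph" where
  "complete_graph n = \<lparr>pverts = {..<n}, parcs = {(i, j). i < n \<and> j < n \<and> i \<noteq> j}\<rparr>"

lemma complete_digraph_complete_graph: "complete_digraph n (with_proj (complete_graph n))"
  unfolding complete_digraph_pair_def by (auto simp: complete_graph_def)

text \<open>The cycle graph is a cycle in the usual sense for \<open>n \<ge> 3\<close>.\<close>

definition cycle_graph :: "nat \<Rightarrow> nat pair_pre_digraph" where
  "cycle_graph n = \<lparr>pverts = {..<n},
     parcs = {(i, j). i < n \<and> j < n \<and> (j = Suc i mod n \<or> i = Suc j mod n)}\<rparr>"

lemma pair_graph_cycle_graph:
  assumes "n \<ge> 3"
  shows "pair_graph (cycle_graph n)"
proof -
  have "finite (parcs (cycle_graph n))"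
    by (rule finite_subset[of _ "{..<n} \<times> {..<n}"]) (auto simp: cycle_graph_def)
  moreover have "Suc i mod n \<noteq> i" if "i < n" for i
    using that assms by (auto simp: mod_Suc)
  ultimately show ?thesis
    by unfold_locales (auto simp: cycle_graph_def symmetric_def sym_def, metis+)
qed

lemma digraph_iso_with_proj_iff:
  assumes "pair_wf_digraph G" "pair_wf_digraph H"
  shows "digraph_iso (with_proj G) (with_proj H) \<longleftrightarrow>
    (\<exists>f. bij_betw f (pverts G) (pverts H) \<and>
      (\<forall>u\<in>pverts G. \<forall>v\<in>pverts G. (u, v) \<in> parcs G \<longleftrightarrow> (f u, f v) \<in> parcs H))"
    (is "?L \<longleftrightarrow> ?R")
proof
  interpret G: pair_wf_digraph G by fact
  assume ?L
  then obtain h where h: "pre_digraph.digraph_isomorphism (with_proj G) h"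
    and H: "with_proj H = app_iso h (with_proj G)"
    unfolding digraph_iso_def by blast
  let ?f = "iso_verts h"
  have inj: "inj_on ?f (pverts G)"
    using h unfolding pre_digraph.digraph_isomorphism_def by simp
  have vH: "pverts H = ?f ` pverts G" and aH: "parcs H = iso_arcs h ` parcs G"
    and tl: "iso_tail h = fst" and hd: "iso_head h = snd"
    using H by (simp_all add: with_proj_def app_iso_def)
  have "iso_arcs h (u, v) = (?f u, ?f v)" if "(u, v) \<in> parcs G" for u v
    using h that unfolding pre_digraph.digraph_isomorphism_def
    by (force simp: tl hd intro: prod_eqI)
  then have "parcs H = {(?f u, ?f v) | u v. (u, v) \<in> parcs G}"
    unfolding aH by force
  then have "(u, v) \<in> parcs G \<longleftrightarrow> (?f u, ?f v) \<in> parcs H"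
    if "u \<in> pverts G" "v \<in> pverts G" for u v
    using that inj by auto (metis G.in_arcsD1 G.in_arcsD2 inj_onD)
  then show ?R using inj vH by (auto simp: bij_betw_def)
next
  interpret G: pair_wf_digraph G by fact
  interpret H: pair_wf_digraph H by fact
  assume ?R
  then obtain f where f: "bij_betw f (pverts G) (pverts H)"
    and e: "\<And>u v. u \<in> pverts G \<Longrightarrow> v \<in> pverts G \<Longrightarrow> (u, v) \<in> parcs G \<longleftrightarrow> (f u, f v) \<in> parcs H"
    by blast
  have inj: "inj_on f (pverts G)" and im: "f ` pverts G = pverts H"
    using f by (auto simp: bij_betw_def)
  let ?h = "\<lparr>iso_verts = f, iso_arcs = map_prod f f, iso_head = snd, iso_tail = fst\<rparr>"
  have "inj_on (map_prod f f) (parcs G)"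
    by (intro map_prod_inj_on[OF inj inj, THEN inj_on_subset]) (auto dest: G.in_arcsD1 G.in_arcsD2)
  then have "pre_digraph.digraph_isomorphism (with_proj G) ?h"
    unfolding pre_digraph.digraph_isomorphism_def using inj G.wf_digraph by auto
  moreover have "map_prod f f ` parcs G = parcs H"
  proof
    show "map_prod f f ` parcs G \<subseteq> parcs H"
      using e by (auto dest: G.in_arcsD1 G.in_arcsD2)
    show "parcs H \<subseteq> map_prod f f ` parcs G"
    proof
      fix a assume a: "a \<in> parcs H"
      obtain x y where xy: "a = (x, y)" by fastforce
      have "x \<in> f ` pverts G" "y \<in> f ` pverts G"
        using a xy im by (auto dest: H.in_arcsD1 H.in_arcsD2)
      then obtain u v where uv: "u \<in> pverts G" "v \<in> pverts G" "x = f u" "y = f v"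
        by blast
      then have "(u, v) \<in> parcs G"
        using a xy e by blast
      then show "a \<in> map_prod f f ` parcs G"
        using xy uv by (auto intro!: rev_image_eqI)
    qed
  qed
  then have "with_proj H = app_iso ?h (with_proj G)"
    by (simp add: with_proj_def app_iso_def im)
  ultimately show ?L unfolding digraph_iso_def by blast
qed

text \<open>
  \<open>B\<close> assigns to every vertex of \<open>H\<close> its branch set; contracting the branch sets in \<open>G\<close> and
  deleting superfluous vertices and edges yields \<open>H\<close>. Branch sets are nonempty because
  \<^const>\<open>connected\<close> demands it.
\<close>
definition is_minor :: "'b pair_pre_digraph \<Rightarrow> 'a pair_pre_digraph \<Rightarrow> bool" where
  "is_minor H G \<longleftrightarrow> (\<exists>B :: 'b \<Rightarrow> 'a set.
     (\<forall>x\<in>pverts H. B x \<subseteq> pverts G \<and> connected (with_proj G \<restriction> B x)) \<and>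
     (\<forall>x\<in>pverts H. \<forall>y\<in>pverts H. x \<noteq> y \<longrightarrow> B x \<inter> B y = {}) \<and>
     (\<forall>(x, y)\<in>parcs H. \<exists>u\<in>B x. \<exists>v\<in>B y. (u, v) \<in> parcs G))"

definition proper_coloring :: "'a pair_pre_digraph \<Rightarrow> ('a \<Rightarrow> 'c) \<Rightarrow> bool" where
  "proper_coloring G \<phi> \<longleftrightarrow> (\<forall>(u, v)\<in>parcs G. \<phi> u \<noteq> \<phi> v)"

definition proper_conflict_free_coloring :: "'a pair_pre_digraph \<Rightarrow> ('a \<Rightarrow> 'c) \<Rightarrow> bool" where
  "proper_conflict_free_coloring G \<phi> \<longleftrightarrow> proper_coloring G \<phi> \<and>
     (\<forall>v\<in>pverts G. neighborhood G v \<noteq> {} \<longrightarrow> (\<exists>c. \<exists>!u. u \<in> neighborhood G v \<and> \<phi> u = c))"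

text \<open>
  The type argument supplies the type of colors. Finiteness of the lists is explicit because
  \<^const>\<open>card\<close> of an infinite set is 0.
\<close>
definition pcf_degree_plus_choosable :: "'c itself \<Rightarrow> nat \<Rightarrow> 'a pair_pre_digraph \<Rightarrow> bool" where
  "pcf_degree_plus_choosable (_ :: 'c itself) k G \<longleftrightarrow>
     (\<forall>L :: 'a \<Rightarrow> 'c set.
        (\<forall>v\<in>pverts G. finite (L v) \<and> card (L v) = degree G v + k) \<longrightarrow>
        (\<exists>\<phi>. proper_conflict_free_coloring G \<phi> \<and> (\<forall>v\<in>pverts G. \<phi> v \<in> L v)))"

end

theory Submission
  imports Defs
begin

text \<open>
  Consider a smallest counterexample. Since all degrees are at most 4, once all neighbors of a vertex
  except one are colored, at most one color of the last neighbor is harmful for that vertex. Hence a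
  vertex of degree \<open>d\<close> that is colored last has to avoid at most \<open>2 d\<close> colors, and configurations
  with many 2-vertices can be deleted, the rest colored by induction, and the coloring extended. To
  make the induction go through for disconnected induced subgraphs, lists may be larger than
  degree + 2, and only 5-cycle components all of whose lists have size exactly 4 are excluded;
  deleting vertices cannot create such a component, because the neighbors of deleted vertices keep a
  spare color.

  In a smallest counterexample no four 2-vertices are consecutive, so the vertices of degree at least
  3 (branch vertices) are joined by threads with at most three inner vertices. Contracting the threads
  gives a \<open>K\<^sub>4\<close>-minor-free simple graph on the branch vertices, which has a vertex of degree at most
  2 by Dirac's theorem. So some branch vertex \<open>x\<close> sends all its threads to at most two branch
  vertices. If \<open>x\<close> has degree 3, two parallel threads have at most one inner vertex each and are
  reducible. If \<open>x\<close> has degree 4, we delete \<open>x\<close> and its threads: the list of \<open>x\<close> has six colors, and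
  a thread from \<open>x\<close> to \<open>y\<close> can be colored last as soon as the list of its first vertex contains three
  colors different from the colors of \<open>x\<close> and \<open>y\<close>.
\<close>

section \<open>Minors and cycles\<close>

text \<open>The obstacle is a count. A vertex of degree \<open>d\<close> has \<open>d + 2\<close>
  colors but may have to avoid \<open>2 d\<close> of them: the colors of its neighbors and one
  harmful color for each neighbor. This suffices outright only for \<open>d \<le> 1\<close>; a
  2-vertex is one color short. A reducible configuration gains the missing color, for instance
  because a neighbor already sees a color exactly once, or because several vertices are colored
  together. A five-cycle may fail, since any two of its vertices are adjacent or have a common
  neighbor of degree 2, so that it needs five different colors. At a branch vertex \<open>x\<close>
  of degree 4 the difficulty is \<open>x\<close> itself: the first vertex of a thread may have only
  four colors, and the colors of both ends may leave just two. The six colors of \<open>x\<close>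
  decide this: either one of them leaves three, or counting exhibits a color that occurs once around
  \<open>x\<close>.\<close>

locale sgraph =
  fixes E :: "'a \<Rightarrow> 'a \<Rightarrow> bool"
  assumes sym: "E u v \<Longrightarrow> E v u"
    and irr: "\<not> E v v"

definition nb :: "('a \<Rightarrow> 'a \<Rightarrow> bool) \<Rightarrow> 'a set \<Rightarrow> 'a \<Rightarrow> 'a set" where
  "nb E V v = {u \<in> V. E v u}"

definition conn :: "('a \<Rightarrow> 'a \<Rightarrow> bool) \<Rightarrow> 'a set \<Rightarrow> bool" where
  "conn E B \<longleftrightarrow> B \<noteq> {} \<and> (\<forall>x\<in>B. \<forall>y\<in>B. (\<lambda>a b. E a b \<and> a \<in> B \<and> b \<in> B)\<^sup>*\<^sup>* x y)"

definition K4_minor :: "('a \<Rightarrow> 'a \<Rightarrow> bool) \<Rightarrow> 'a set \<Rightarrow> bool" where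
  "K4_minor E V \<longleftrightarrow> (\<exists>B :: nat \<Rightarrow> 'a set. (\<forall>i<4. B i \<subseteq> V \<and> conn E (B i)) \<and>
     (\<forall>i<4. \<forall>j<4. i \<noteq> j \<longrightarrow> B i \<inter> B j = {} \<and> (\<exists>u\<in>B i. \<exists>v\<in>B j. E u v)))"

definition is_cycle :: "('a \<Rightarrow> 'a \<Rightarrow> bool) \<Rightarrow> 'a set \<Rightarrow> (nat \<Rightarrow> 'a) \<Rightarrow> nat \<Rightarrow> bool" where
  "is_cycle E V c n \<longleftrightarrow> 3 \<le> n \<and> inj_on c {..<n} \<and> c ` {..<n} \<subseteq> V \<and>
     (\<forall>i. Suc i < n \<longrightarrow> E (c i) (c (Suc i))) \<and> E (c (n - 1)) (c 0)"

lemma nb_subset: "nb E V v \<subseteq> V"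
  by (auto simp: nb_def)

lemma ex_notin_if_card_gt:
  assumes "length xs < card A"
  shows "\<exists>a\<in>A. a \<notin> set xs"
proof (rule ccontr)
  assume "\<not> ?thesis"
  then have "card A \<le> card (set xs)" by (intro card_mono) auto
  then show False using assms card_length[of xs] by simp
qed

lemma K4_minor_mono:
  assumes "K4_minor E W" "W \<subseteq> V"
  shows "K4_minor E V"
proof -
  obtain B :: "nat \<Rightarrow> 'a set" where B: "\<forall>i<4. B i \<subseteq> W \<and> conn E (B i)"
    "\<forall>i<4. \<forall>j<4. i \<noteq> j \<longrightarrow> B i \<inter> B j = {} \<and> (\<exists>u\<in>B i. \<exists>v\<in>B j. E u v)"
    using assms(1) unfolding K4_minor_def by blast
  show ?thesis
    unfolding K4_minor_def
    by (rule exI[of _ B], intro conjI) (use B(1) assms(2) in blast, rule B(2))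
qed

lemma (in sgraph) conn_if_reachable:
  assumes "r \<in> B" and r: "\<And>x. x \<in> B \<Longrightarrow> (\<lambda>a b. E a b \<and> a \<in> B \<and> b \<in> B)\<^sup>*\<^sup>* r x"
  shows "conn E B"
proof -
  let ?R = "\<lambda>a b. E a b \<and> a \<in> B \<and> b \<in> B"
  have "symp ?R" by (auto intro!: sympI sym)
  then have "symp ?R\<^sup>*\<^sup>*" by (rule symp_rtranclp)
  then have "?R\<^sup>*\<^sup>* x y" if "x \<in> B" "y \<in> B" for x y
    using r[OF that(1)] r[OF that(2)] by (meson rtranclp_trans sympD)
  then show ?thesis using assms(1) by (auto simp: conn_def)
qed

lemma (in sgraph) conn_arc:
  assumes "i < j" and e: "\<And>l. i \<le> l \<Longrightarrow> Suc l < j \<Longrightarrow> E (c l) (c (Suc l))"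
  shows "conn E (c ` {i..<j})"
proof (rule conn_if_reachable[of "c i"])
  let ?R = "\<lambda>a b. E a b \<and> a \<in> c ` {i..<j} \<and> b \<in> c ` {i..<j}"
  have "?R\<^sup>*\<^sup>* (c i) (c (i + k))" if "i + k < j" for k
    using that
  proof (induction k)
    case (Suc k)
    then have "?R\<^sup>*\<^sup>* (c i) (c (i + k))" by simp
    moreover have "?R (c (i + k)) (c (i + Suc k))" using Suc.prems e[of "i + k"] by auto
    ultimately show ?case by (rule rtranclp.rtrancl_into_rtrancl)
  qed simp
  then show "?R\<^sup>*\<^sup>* (c i) x" if "x \<in> c ` {i..<j}" for x
    using that by (metis (no_types, lifting) atLeastLessThan_iff image_iff le_iff_add)
qed (use assms(1) in auto)

lemma (in sgraph) K4_minor_contraction: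
  assumes "K4_minor E' V'"
    and fibre: "\<And>x. x \<in> V' \<Longrightarrow> conn E {v \<in> V. f v = x}"
    and edge: "\<And>x y. x \<in> V' \<Longrightarrow> y \<in> V' \<Longrightarrow> E' x y \<Longrightarrow> \<exists>u\<in>V. \<exists>v\<in>V. f u = x \<and> f v = y \<and> E u v"
  shows "K4_minor E V"
proof -
  obtain B :: "nat \<Rightarrow> 'b set" where B: "\<forall>i<4. B i \<subseteq> V' \<and> conn E' (B i)"
    "\<forall>i<4. \<forall>j<4. i \<noteq> j \<longrightarrow> B i \<inter> B j = {} \<and> (\<exists>u\<in>B i. \<exists>v\<in>B j. E' u v)"
    using assms(1) unfolding K4_minor_def by blast
  have conn': "conn E {v \<in> V. f v \<in> A}" if A: "A \<subseteq> V'" "conn E' A" for A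
  proof -
    let ?F = "{v \<in> V. f v \<in> A}"
    let ?R = "\<lambda>a b. E a b \<and> a \<in> ?F \<and> b \<in> ?F"
    have fib: "?R\<^sup>*\<^sup>* u v" if "u \<in> V" "v \<in> V" "f u = f v" "f u \<in> A" for u v
    proof -
      let ?G = "{v' \<in> V. f v' = f u}"
      have "(\<lambda>a b. E a b \<and> a \<in> ?G \<and> b \<in> ?G)\<^sup>*\<^sup>* u v"
        using fibre[of "f u"] that A(1) unfolding conn_def by auto
      then show ?thesis
        by (rule rtranclp_mono[THEN predicate2D, rotated]) (use that in auto)
    qed
    have "?R\<^sup>*\<^sup>* u v" if u: "u \<in> ?F" and v: "v \<in> ?F" for u v
    proof -
      have "(\<lambda>a b. E' a b \<and> a \<in> A \<and> b \<in> A)\<^sup>*\<^sup>* (f u) (f v)"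
        using A(2) u v unfolding conn_def by auto
      \<comment> \<open>The induction claim covers a whole fibre, because the edge that leaves a
        fibre need not start where the walk entered it.\<close>
      then have "\<forall>w\<in>V. f w = f v \<longrightarrow> ?R\<^sup>*\<^sup>* u w"
      proof (induction)
        case base
        then show ?case using fib u by auto
      next
        case (step y z)
        obtain p q where pq: "p \<in> V" "q \<in> V" "f p = y" "f q = z" "E p q"
          using edge[of y z] step A(1) by blast
        then have "?R\<^sup>*\<^sup>* u p" "?R p q" using step by auto
        then have "?R\<^sup>*\<^sup>* u q" by (rule rtranclp.rtrancl_into_rtrancl)
        then show ?case
          using fib[of q] pq step by (metis (no_types, lifting) rtranclp_trans)
      qed
      then show ?thesis using v by simp
    qed
    moreover have "?F \<noteq> {}"
    proof -
      obtain x where "x \<in> A" using A(2) by (auto simp: conn_def)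
      then show ?thesis using fibre[of x] A(1) by (auto simp: conn_def)
    qed
    ultimately show ?thesis by (simp add: conn_def)
  qed
  show ?thesis
    unfolding K4_minor_def
  proof (intro exI[of _ "\<lambda>i. {v \<in> V. f v \<in> B i}"] conjI allI impI)
    fix i j :: nat assume ij: "i < 4" "j < 4" "i \<noteq> j"
    show "{v \<in> V. f v \<in> B i} \<inter> {v \<in> V. f v \<in> B j} = {}" using ij B(2) by blast
    obtain x y where xy: "x \<in> B i" "y \<in> B j" "E' x y" using ij B(2) by metis
    then obtain p q where "p \<in> V" "q \<in> V" "f p = x" "f q = y" "E p q"
      using edge[of x y] ij B(1) by blast
    with xy show "\<exists>u\<in>{v \<in> V. f v \<in> B i}. \<exists>v\<in>{v \<in> V. f v \<in> B j}. E u v" by blast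
  qed (use B(1) conn' in auto)
qed

text \<open>The cycle is cut into three arcs, each with one of the attachments. The arcs are
  pairwise adjacent along the cycle, and \<open>R\<close> is the fourth branch set.\<close>

lemma (in sgraph) K4_minor_if_three_attachments:
  assumes cyc: "is_cycle E V c n" and R: "R \<subseteq> V" "R \<inter> c ` {..<n} = {}" "conn E R"
    and ijk: "i < j" "j < k" "k < n"
    and att: "\<And>l. l \<in> {i, j, k} \<Longrightarrow> \<exists>r\<in>R. E r (c l)"
  shows "K4_minor E V"
proof -
  define B where "B = (\<lambda>m::nat. if m = 0 then R else if m = 1 then c ` {0..<j}
    else if m = 2 then c ` {j..<k} else c ` {k..<n})"
  have e: "E (c l) (c (Suc l))" if "Suc l < n" for l using cyc that by (simp add: is_cycle_def)
  have inj: "c a \<noteq> c b" if "a < n" "b < n" "a \<noteq> b" for a b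
    using cyc that by (auto simp: is_cycle_def inj_on_def)
  have cV: "c a \<in> V" if "a < n" for a using cyc that by (auto simp: is_cycle_def)
  have cn: "conn E (c ` {0..<j})" "conn E (c ` {j..<k})" "conn E (c ` {k..<n})"
    using ijk by (auto intro!: conn_arc e)
  have cases4: "m = 0 \<or> m = 1 \<or> m = 2 \<or> m = 3" if "m < 4" for m :: nat using that by auto
  have adj: "\<exists>u\<in>B a. \<exists>v\<in>B b. E u v" if "a < b" "b < 4" for a b
  proof -
    have "\<exists>r\<in>R. E r (c i)" "\<exists>r\<in>R. E r (c j)" "\<exists>r\<in>R. E r (c k)" using att by auto
    moreover have "E (c (j - 1)) (c j)" "E (c (k - 1)) (c k)" "E (c 0) (c (n - 1))"
      using e[of "j - 1"] e[of "k - 1"] ijk cyc by (auto simp: is_cycle_def intro: sym)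
    ultimately show ?thesis
      using that cases4[of b] ijk
      by (fastforce simp: B_def less_Suc_eq numeral_2_eq_2 numeral_3_eq_3)
  qed
  show ?thesis
    unfolding K4_minor_def
  proof (intro exI[of _ B] conjI allI impI)
    fix a b :: nat assume ab: "a < 4" "b < 4" "a \<noteq> b"
    show "\<exists>u\<in>B a. \<exists>v\<in>B b. E u v"
      using adj[of a b] adj[of b a] ab by (metis linorder_neqE_nat sym)
    have "c ` {0..<j} \<inter> c ` {j..<k} = {}" "c ` {0..<j} \<inter> c ` {k..<n} = {}"
      "c ` {j..<k} \<inter> c ` {k..<n} = {}" using inj ijk by fastforce+
    moreover have "R \<inter> c ` {0..<j} = {}" "R \<inter> c ` {j..<k} = {}" "R \<inter> c ` {k..<n} = {}"
      using R(2) ijk by fastforce+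
    ultimately show "B a \<inter> B b = {}"
      using cases4[OF ab(1)] cases4[OF ab(2)] ab(3) by (auto simp: B_def)
  next
    fix a :: nat assume "a < 4"
    then show "B a \<subseteq> V" "conn E (B a)"
      using cases4[of a] R cn cV ijk by (auto simp: B_def)
  qed
qed

text \<open>A chord closes the arc between its ends. The two excluded index patterns are the edges
  of the cycle itself. A shortest cycle therefore has no chord.\<close>

lemma (in sgraph) shorter_cycle:
  assumes cyc: "is_cycle E V c n" and ij: "i < j" "j < n" "E (c i) (c j)"
    and "j \<noteq> Suc i" "\<not> (i = 0 \<and> j = n - 1)"
  shows "\<exists>c' m. m < n \<and> is_cycle E V c' m"
proof (intro exI conjI)
  show "j - i + 1 < n" using ij assms(5,6) by auto
  have "inj_on (\<lambda>l. c (i + l)) {..<j - i + 1}"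
  proof (rule inj_onI)
    fix x y assume "x \<in> {..<j - i + 1}" "y \<in> {..<j - i + 1}" and eq: "c (i + x) = c (i + y)"
    then have "i + x < n" "i + y < n" using ij by auto
    then have "i + x = i + y"
      using cyc eq unfolding is_cycle_def by (meson inj_onD lessThan_iff)
    then show "x = y" by simp
  qed
  moreover have "c (i + l) \<in> V" if "l < j - i + 1" for l
    using cyc ij that by (auto simp: is_cycle_def)
  ultimately show "is_cycle E V (\<lambda>l. c (i + l)) (j - i + 1)"
    using cyc ij assms(5) unfolding is_cycle_def by (auto intro: sym)
qed

text \<open>Take a longest path. An end outside \<open>K\<close> has all its neighbors on the path,
  and one of them is far enough along to close a cycle. If both ends lie in \<open>K\<close>, they
  are adjacent and close the path themselves.\<close>

lemma (in sgraph) ex_cycle: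
  assumes fin: "finite V" and K: "K \<subseteq> V" "card K \<le> 2" "\<And>u v. u \<in> K \<Longrightarrow> v \<in> K \<Longrightarrow> u \<noteq> v \<Longrightarrow> E u v"
    and "v \<in> V - K" and deg: "\<And>v. v \<in> V - K \<Longrightarrow> card (nb E V v) \<ge> 3"
  shows "\<exists>c n. is_cycle E V c n"
proof -
  define P where "P = {xs. distinct xs \<and> set xs \<subseteq> V \<and> successively E xs}"
  have rev_P: "rev xs \<in> P" if "xs \<in> P" for xs
    using that by (auto simp: P_def successively_rev intro: successively_mono[of E xs] sym)
  have cyc: "\<exists>c n. is_cycle E V c n" if xs: "xs \<in> P" and j: "2 \<le> j" "j < length xs" "E (xs ! 0) (xs ! j)" for xs j
  proof (intro exI)
    show "is_cycle E V ((!) xs) (Suc j)"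
      using xs j unfolding is_cycle_def P_def
      by (auto simp: inj_on_def nth_eq_iff_index_eq successively_conv_nth intro: sym)
  qed
  have "length xs \<le> card V" if "xs \<in> P" for xs
    using that fin by (metis (mono_tags, lifting) P_def card_mono distinct_card mem_Collect_eq)
  then obtain xs where xs: "xs \<in> P" and mx: "\<And>ys. ys \<in> P \<Longrightarrow> length ys \<le> length xs"
    using ex_has_greatest_nat[of "\<lambda>xs. xs \<in> P" "[]" length "Suc (card V)"] by (auto simp: P_def less_Suc_eq_le)
  have len: "3 \<le> length xs"
  proof -
    have "3 \<le> card (nb E V v)" using deg[OF assms(5)] .
    then obtain a b where "a \<in> nb E V v" "b \<in> nb E V v" "a \<noteq> b"
      using ex_notin_if_card_gt[of "[]" "nb E V v"] ex_notin_if_card_gt[of "[a]" "nb E V v" for a]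
      by fastforce
    then have "[a, v, b] \<in> P" using assms(5) by (auto simp: P_def nb_def irr intro: sym)
    then show ?thesis using mx by fastforce
  qed
  have main: "\<exists>c n. is_cycle E V c n" if ys: "ys \<in> P" "length ys = length xs" and h: "ys ! 0 \<notin> K" for ys
  proof -
    let ?h = "ys ! 0"
    have ne: "ys \<noteq> []" using len ys by auto
    have "?h \<in> set ys" using ne by simp
    then have hV: "?h \<in> V - K" using ys h by (auto simp: P_def)
    have sub: "nb E V ?h \<subseteq> set ys"
    proof
      fix a assume a: "a \<in> nb E V ?h"
      show "a \<in> set ys"
      proof (rule ccontr)
        assume "a \<notin> set ys"
        then have "a # ys \<in> P" using a ys ne
          by (auto simp: P_def nb_def successively_Cons hd_conv_nth intro: sym)
        then show False using mx ys(2) by fastforce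
      qed
    qed
    obtain a where a: "a \<in> nb E V ?h" "a \<notin> {ys ! 0, ys ! 1}"
      using ex_notin_if_card_gt[of "[ys ! 0, ys ! 1]" "nb E V ?h"] deg[OF hV] by auto
    then obtain j where "j < length ys" "ys ! j = a"
      using sub by (meson in_set_conv_nth subsetD)
    with a have "j < length ys" "ys ! j \<in> nb E V ?h" "j \<noteq> 0" "j \<noteq> 1"
      by (auto intro: gr0I)
    then show ?thesis using cyc[OF ys(1), of j] by (auto simp: nb_def)
  qed
  show ?thesis
  proof (cases "xs ! 0 \<in> K \<and> rev xs ! 0 \<in> K")
    case True
    have "rev xs ! 0 = xs ! (length xs - 1)" using len by (subst rev_nth) auto
    moreover have "xs ! 0 \<noteq> xs ! (length xs - 1)"
      using xs len by (subst nth_eq_iff_index_eq) (auto simp: P_def)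
    ultimately have "E (xs ! 0) (xs ! (length xs - 1))" using True K(3) by auto
    then show ?thesis using cyc[OF xs, of "length xs - 1"] len by simp
  next
    case False
    then show ?thesis using main[OF xs] main[OF rev_P[OF xs]] by auto
  qed
qed

section \<open>Components outside a shortest cycle, and Dirac's theorem\<close>

lemma conn_singleton: "conn E {x}"
  by (simp add: conn_def)

lemma (in sgraph) ex_component:
  assumes "r \<in> W"
  shows "\<exists>R. r \<in> R \<and> R \<subseteq> W \<and> conn E R \<and> (\<forall>v\<in>R. \<forall>u\<in>W. E v u \<longrightarrow> u \<in> R)"
proof -
  let ?Q = "\<lambda>a b. E a b \<and> a \<in> W \<and> b \<in> W"
  define R where "R = {v. ?Q\<^sup>*\<^sup>* r v}"
  have sub: "v \<in> W" if "?Q\<^sup>*\<^sup>* r v" for v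
    using that assms by (induction) auto
  have closed: "u \<in> R" if "v \<in> R" "u \<in> W" "E v u" for v u
    using that sub[of v] unfolding R_def by (auto intro: rtranclp.rtrancl_into_rtrancl)
  have r: "r \<in> R" by (simp add: R_def)
  have cn: "conn E R"
  proof (rule conn_if_reachable[OF r])
    fix v assume "v \<in> R"
    then have "?Q\<^sup>*\<^sup>* r v" by (simp add: R_def)
    then show "(\<lambda>a b. E a b \<and> a \<in> R \<and> b \<in> R)\<^sup>*\<^sup>* r v"
    proof (induction)
      case (step y z)
      then have "y \<in> R" "z \<in> R" by (auto simp: R_def intro: rtranclp.rtrancl_into_rtrancl)
      with step show ?case by (auto intro: rtranclp.rtrancl_into_rtrancl)
    qed simp
  qed
  have "R \<subseteq> W"
  proof
    fix v assume "v \<in> R"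
    then show "v \<in> W" unfolding R_def mem_Collect_eq by (rule sub)
  qed
  then show ?thesis using r cn closed by (intro exI[of _ R] conjI ballI impI)
qed

text \<open>If \<open>T\<close> has fewer than two elements the pair is padded with further indices,
  so that later there are always two distinct cycle vertices to work with.\<close>

lemma three_or_within_pair:
  fixes T :: "nat set"
  assumes "T \<subseteq> {..<n}" "2 \<le> n"
  shows "(\<exists>i\<in>T. \<exists>j\<in>T. \<exists>k\<in>T. i < j \<and> j < k) \<or> (\<exists>p q. p < q \<and> q < n \<and> T \<subseteq> {p, q})"
proof (cases "T = {}")
  case True
  then show ?thesis using assms(2) by (intro disjI2 exI[of _ 0] exI[of _ 1]) auto
next
  case False
  have fin: "finite T" using assms(1) finite_subset by auto
  let ?a = "Min T" and ?b = "Max T"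
  have ab: "?a \<in> T" "?b \<in> T" "\<And>t. t \<in> T \<Longrightarrow> ?a \<le> t \<and> t \<le> ?b" using False fin by auto
  show ?thesis
  proof (cases "T \<subseteq> {?a, ?b}")
    case True
    show ?thesis
    proof (cases "?a = ?b")
      case eq: True
      have "?b < n" using ab assms(1) by auto
      moreover have "T \<subseteq> {?b}" using True eq by simp
      moreover have "1 < n" using assms(2) by simp
      ultimately show ?thesis
        by (cases "?b = 0") (blast, metis gr0I insert_mono order_trans empty_subsetI subset_insertI)
    next
      case neq: False
      then have "?a < ?b" "?b < n" using ab assms(1) by (auto simp: order_le_less)
      then show ?thesis using True by blast
    qed
  next
    case F: False
    then obtain j where "j \<in> T" "j \<noteq> ?a" "j \<noteq> ?b" by blast
    then have "?a < j" "j < ?b" using ab(3)[of j] by auto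
    then show ?thesis using ab \<open>j \<in> T\<close> by blast
  qed
qed

text \<open>Dirac's theorem with a clique of at most two vertices exempted from the degree
  condition, as its induction needs. Let \<open>C\<close> be a shortest cycle. A component of the
  rest with three attachments on \<open>C\<close> gives the minor. A component with at most two that
  avoids \<open>K\<close> is kept with these two vertices, joined by an edge, as the new clique. If
  every component meets \<open>K\<close>, there is only one; a cycle vertex without neighbor in it
  has degree 2, so lies in \<open>K\<close> and is adjacent to the vertex of \<open>K\<close> in the
  component, a contradiction.\<close>

theorem K4_minor_if_clique_degree:
  assumes "sgraph E" "finite V" "K \<subseteq> V" "card K \<le> 2"
    and "\<And>u v. u \<in> K \<Longrightarrow> v \<in> K \<Longrightarrow> u \<noteq> v \<Longrightarrow> E u v"
    and "V - K \<noteq> {}" "\<And>v. v \<in> V - K \<Longrightarrow> card (nb E V v) \<ge> 3"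
  shows "K4_minor E V"
  using assms
proof (induction "card V" arbitrary: E V K rule: less_induct)
  case less
  interpret sgraph E by fact
  note fin = less.prems(2)
  define P where "P = (\<lambda>n. \<exists>c. is_cycle E V c n)"
  obtain v0 where "v0 \<in> V - K" using less.prems(6) by blast
  then have "\<exists>c n. is_cycle E V c n"
    using ex_cycle[of V K v0] less.prems by blast
  then have "\<exists>n. P n" by (auto simp: P_def)
  then obtain n where n: "P n" "\<And>m. m < n \<Longrightarrow> \<not> P m" using exists_least_iff[of P] by blast
  obtain c where cyc: "is_cycle E V c n" using n(1) by (auto simp: P_def)
  define C where "C = c ` {..<n}"
  have n3: "3 \<le> n" and inj: "inj_on c {..<n}" and CV: "C \<subseteq> V"
    and ce: "\<And>i. Suc i < n \<Longrightarrow> E (c i) (c (Suc i))" and cl: "E (c (n - 1)) (c 0)"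
    using cyc by (auto simp: is_cycle_def C_def)
  \<comment> \<open>By minimality of \<open>n\<close> the cycle has no chord.\<close>
  have deg2: "card (nb E V (c i) \<inter> C) \<le> 2" if i: "i < n" for i
  proof -
    have chord: "b = Suc a \<or> (a = 0 \<and> b = n - 1)" if "a < b" "b < n" "E (c a) (c b)" for a b
      using shorter_cycle[OF cyc that] n(2) unfolding P_def by blast
    let ?S = "{c (if i = 0 then n - 1 else i - 1), c (if i = n - 1 then 0 else i + 1)}"
    have "nb E V (c i) \<inter> C \<subseteq> ?S"
    proof
      fix u assume "u \<in> nb E V (c i) \<inter> C"
      then obtain j where j: "j < n" "u = c j" "E (c i) (c j)" by (auto simp: nb_def C_def)
      then have "i \<noteq> j" using irr by auto
      then have "j = Suc i \<or> i = 0 \<and> j = n - 1 \<or> i = Suc j \<or> j = 0 \<and> i = n - 1"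
        using chord[of i j] chord[of j i] i j sym[OF j(3)] by (meson linorder_neqE_nat)
      then have "j = (if i = 0 then n - 1 else i - 1) \<or> j = (if i = n - 1 then 0 else i + 1)"
        using i j(1) n3 by auto
      then show "u \<in> ?S" using j(2) by blast
    qed
    then have "card (nb E V (c i) \<inter> C) \<le> card ?S" by (intro card_mono) auto
    also have "\<dots> \<le> 2" by (simp add: card_insert_if)
    finally show ?thesis .
  qed
  have comp: "K4_minor E V \<or> (\<exists>p q. p < q \<and> q < n \<and> (\<forall>i<n. (\<exists>r\<in>R. E r (c i)) \<longrightarrow> i \<in> {p, q}))"
    if R: "R \<subseteq> V - C" "conn E R" for R
  proof -
    define T where "T = {i. i < n \<and> (\<exists>r\<in>R. E r (c i))}"
    have "T \<subseteq> {..<n}" by (auto simp: T_def)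
    from three_or_within_pair[OF this] n3
    have "(\<exists>i\<in>T. \<exists>j\<in>T. \<exists>k\<in>T. i < j \<and> j < k) \<or> (\<exists>p q. p < q \<and> q < n \<and> T \<subseteq> {p, q})" by simp
    then show ?thesis
    proof (elim disjE bexE)
      fix i j k assume "i \<in> T" "j \<in> T" "k \<in> T" "i < j \<and> j < k"
      then have "K4_minor E V"
        using R by (intro K4_minor_if_three_attachments[OF cyc, of R i j k]) (auto simp: T_def C_def)
      then show ?thesis ..
    next
      assume "\<exists>p q. p < q \<and> q < n \<and> T \<subseteq> {p, q}"
      then show ?thesis unfolding T_def by blast
    qed
  qed
  show ?case
  proof (cases "\<exists>R r. r \<in> R \<and> R \<subseteq> V - C \<and> conn E R \<and> (\<forall>v\<in>R. \<forall>u\<in>V - C. E v u \<longrightarrow> u \<in> R) \<and> R \<inter> K = {}")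
    case True
    then obtain R r where R: "r \<in> R" "R \<subseteq> V - C" "conn E R" "R \<inter> K = {}"
      and closed: "\<And>v u. v \<in> R \<Longrightarrow> u \<in> V - C \<Longrightarrow> E v u \<Longrightarrow> u \<in> R" by blast
    from comp[OF R(2,3)] show ?thesis
    proof (elim disjE exE conjE)
      fix p q assume pq: "p < q" "q < n" and att: "\<forall>i<n. (\<exists>r\<in>R. E r (c i)) \<longrightarrow> i \<in> {p, q}"
      let ?p = "c p" and ?q = "c q"
      \<comment> \<open>The new edge makes the two attachments a clique and stands for a part of the
        cycle. A third cycle vertex is dropped, so the new vertex set is smaller.\<close>
      define E' where "E' = (\<lambda>u v. E u v \<or> (u = ?p \<and> v = ?q) \<or> (u = ?q \<and> v = ?p))"
      define V' where "V' = R \<union> {?p, ?q}"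
      have neq: "?p \<noteq> ?q" using inj pq by (auto simp: inj_on_def)
      have sg': "sgraph E'" using neq by unfold_locales (auto simp: E'_def irr intro: sym)
      have pqC: "?p \<in> C" "?q \<in> C" using pq by (auto simp: C_def)
      have V'V: "V' \<subseteq> V" using R(2) pqC CV by (auto simp: V'_def)
      obtain l where l: "l < n" "l \<noteq> p" "l \<noteq> q"
        using ex_notin_if_card_gt[of "[p, q]" "{..<n}"] n3 by auto
      then have "c l \<in> V" "c l \<notin> V'" using inj pq R(2) CV by (auto simp: V'_def C_def inj_on_def)
      then have "card V' < card V" using V'V fin by (intro psubset_card_mono) auto
      moreover have "3 \<le> card (nb E' V' v)" if v: "v \<in> V' - {?p, ?q}" for v
      proof -
        have vR: "v \<in> R" using v by (auto simp: V'_def)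
        have "nb E V v \<subseteq> nb E' V' v"
        proof
          fix u assume u: "u \<in> nb E V v"
          show "u \<in> nb E' V' v"
          proof (cases "u \<in> C")
            case True
            then obtain i where "i < n" "u = c i" by (auto simp: C_def)
            then show ?thesis using u vR att by (auto simp: nb_def V'_def E'_def)
          next
            case False
            then show ?thesis using u vR closed[OF vR, of u] by (auto simp: nb_def V'_def E'_def)
          qed
        qed
        moreover have "finite (nb E' V' v)"
          using fin V'V nb_subset finite_subset by metis
        ultimately show ?thesis using less.prems(7)[of v] card_mono[of "nb E' V' v" "nb E V v"] vR R by fastforce
      qed
      ultimately have minor: "K4_minor E' V'"
      proof (intro less.hyps[of V' E' "{?p, ?q}"])
        show "finite V'" using fin V'V finite_subset by auto
        show "V' - {?p, ?q} \<noteq> {}" using R(1,2) pqC by (auto simp: V'_def)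
      qed (use sg' in \<open>auto simp: V'_def E'_def card_insert_if\<close>)
      \<comment> \<open>The two arcs of the cycle are contracted to \<open>?p\<close> and
        \<open>?q\<close>; the edge from index \<open>q - 1\<close> to \<open>q\<close> realizes the
        new edge. The host is restricted to \<open>R \<union> C\<close>, because \<open>f\<close>
        also sends every other vertex to \<open>?q\<close> and its fibre need not be connected
        then.\<close>
      define f where "f = (\<lambda>v. if v \<in> R then v else if v \<in> c ` {0..<q} then ?p else ?q)"
      have fC: "f (c i) = (if i < q then ?p else ?q)" if "i < n" for i
      proof -
        have "c i \<in> C" using that by (auto simp: C_def)
        then have "c i \<notin> R" using R(2) by auto
        moreover have "c i \<in> c ` {0..<q} \<longleftrightarrow> i < q"
          using inj that pq by (subst inj_on_image_mem_iff[of c "{..<n}"]) auto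
        ultimately show ?thesis by (simp add: f_def)
      qed
      have "K4_minor E (R \<union> C)"
      proof (rule K4_minor_contraction[OF minor])
        fix x assume "x \<in> V'"
        then consider "x \<in> R" | "x = ?p" | "x = ?q" by (auto simp: V'_def)
        then show "conn E {v \<in> R \<union> C. f v = x}"
        proof cases
          case 1
          then have "{v \<in> R \<union> C. f v = x} = {x}"
            using R(2) pqC by (auto simp: f_def)
          then show ?thesis by (simp add: conn_singleton)
        next
          case 2
          have "{v \<in> R \<union> C. f v = x} = c ` {0..<q}"
          proof (intro set_eqI iffI)
            fix v assume "v \<in> {v \<in> R \<union> C. f v = x}"
            moreover from this have "v \<notin> R" using 2 pqC R(2) by (auto simp: f_def)
            ultimately obtain i where "i < n" "v = c i" "f v = x" by (auto simp: C_def)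
            then show "v \<in> c ` {0..<q}" using fC[of i] 2 neq by (auto split: if_splits)
          next
            fix v assume "v \<in> c ` {0..<q}"
            then show "v \<in> {v \<in> R \<union> C. f v = x}" using fC pq 2 by (auto simp: C_def)
          qed
          then show ?thesis using conn_arc[of 0 q c] ce pq by simp
        next
          case 3
          have "{v \<in> R \<union> C. f v = x} = c ` {q..<n}"
          proof (intro set_eqI iffI)
            fix v assume "v \<in> {v \<in> R \<union> C. f v = x}"
            moreover from this have "v \<notin> R" using 3 pqC R(2) by (auto simp: f_def)
            ultimately obtain i where "i < n" "v = c i" "f v = x" by (auto simp: C_def)
            then show "v \<in> c ` {q..<n}" using fC[of i] 3 neq by (auto split: if_splits)
          next
            fix v assume "v \<in> c ` {q..<n}"
            then show "v \<in> {v \<in> R \<union> C. f v = x}" using fC pq 3 by (auto simp: C_def)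
          qed
          then show ?thesis using conn_arc[of q n c] ce pq by simp
        qed
      next
        fix x y assume xy: "x \<in> V'" "y \<in> V'" "E' x y"
        have fid: "f u = u" if "u \<in> V'" for u
          using that fC[of p] fC[of q] pq by (auto simp: V'_def f_def)
        have sub: "V' \<subseteq> R \<union> C" using pqC by (auto simp: V'_def)
        have e: "E (c (q - 1)) ?q" using ce[of "q - 1"] pq by simp
        have q1: "f (c (q - 1)) = ?p" "c (q - 1) \<in> C" using fC[of "q - 1"] pq by (auto simp: C_def)
        from xy(3) show "\<exists>u\<in>R \<union> C. \<exists>v\<in>R \<union> C. f u = x \<and> f v = y \<and> E u v"
          unfolding E'_def
        proof (elim disjE conjE)
          assume "E x y" then show ?thesis using fid sub xy by blast
        next
          assume "x = ?p" "y = ?q"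
          then show ?thesis using e q1 pqC fid[of ?q] by (auto simp: V'_def)
        next
          assume "x = ?q" "y = ?p"
          then show ?thesis using sym[OF e] q1 pqC fid[of ?q] by (auto simp: V'_def)
        qed
      qed
      then show ?thesis by (rule K4_minor_mono) (use R(2) CV in auto)
    qed
  next
    case False
    have meets: "R \<inter> K \<noteq> {}"
      if "r \<in> R" "R \<subseteq> V - C" "conn E R" "\<forall>v\<in>R. \<forall>u\<in>V - C. E v u \<longrightarrow> u \<in> R" for r R
      using False that by blast
    have cardC: "card C = n" using inj by (simp add: C_def card_image)
    have "\<not> C \<subseteq> K"
      using card_mono[of K C] less.prems(2,3,4) cardC n3 finite_subset by fastforce
    then obtain i0 where i0: "i0 < n" "c i0 \<notin> K" by (auto simp: C_def)
    then have c0: "c i0 \<in> V - K" using CV by (auto simp: C_def)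
    have "\<not> nb E V (c i0) \<subseteq> C"
      using deg2[OF i0(1)] less.prems(7)[OF c0] by (auto simp: Int_absorb2)
    then obtain r where r: "r \<in> V - C" by (auto simp: nb_def)
    obtain R where R: "r \<in> R" "R \<subseteq> V - C" "conn E R" "\<forall>v\<in>R. \<forall>u\<in>V - C. E v u \<longrightarrow> u \<in> R"
      using ex_component[OF r] by (elim exE conjE)
    obtain k where k: "k \<in> R" "k \<in> K" using meets[OF R] by blast
    \<comment> \<open>Two components that meet the clique \<open>K\<close> coincide.\<close>
    have all: "s \<in> R" if s: "s \<in> V - C" for s
    proof -
      obtain S where S: "s \<in> S" "S \<subseteq> V - C" "conn E S" "\<forall>v\<in>S. \<forall>u\<in>V - C. E v u \<longrightarrow> u \<in> S"
        using ex_component[OF s] by (elim exE conjE)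
      obtain k' where k': "k' \<in> S" "k' \<in> K" using meets[OF S] by blast
      have "k' \<in> R" using less.prems(5)[OF k(2) k'(2)] k k' R(4) S(2) by blast
      have "(\<lambda>a b. E a b \<and> a \<in> S \<and> b \<in> S)\<^sup>*\<^sup>* k' s" using S(1,3) k'(1) by (auto simp: conn_def)
      then show ?thesis using \<open>k' \<in> R\<close> S(2) R(4) by (induction) auto
    qed
    from comp[OF R(2,3)] show ?thesis
    proof (elim disjE exE conjE)
      fix p q assume pq: "p < q" "q < n" and att: "\<forall>i<n. (\<exists>r\<in>R. E r (c i)) \<longrightarrow> i \<in> {p, q}"
      obtain l where l: "l < n" "l \<noteq> p" "l \<noteq> q"
        using ex_notin_if_card_gt[of "[p, q]" "{..<n}"] n3 by auto
      then have noR: "\<not> E r (c l)" if "r \<in> R" for r using att that by auto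
      have "nb E V (c l) \<subseteq> C" using noR all by (auto simp: nb_def intro: sym)
      then have "card (nb E V (c l)) \<le> 2" using deg2[OF l(1)] by (simp add: Int_absorb2)
      moreover have clC: "c l \<in> C" using l by (simp add: C_def)
      ultimately have "c l \<in> K" using less.prems(7)[of "c l"] CV by fastforce
      moreover have "k \<noteq> c l" using k R(2) clC by auto
      ultimately show ?thesis using less.prems(5)[of k "c l"] k noR[of k] by blast
    qed
  qed
qed

section \<open>Coloring induced subgraphs\<close>

definition has_unique_color :: "'a set \<Rightarrow> ('a \<Rightarrow> 'c) \<Rightarrow> bool" where
  "has_unique_color A \<phi> \<longleftrightarrow> (\<exists>u\<in>A. \<forall>u'\<in>A. \<phi> u' = \<phi> u \<longrightarrow> u' = u)"

text \<open>Neighborhoods are those of the subgraph induced by \<open>W\<close>. \<open>D\<close>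
  collects the vertices whose conflict-free condition is postponed because their neighborhoods are
  still to grow.\<close>

definition pcf_except ::
    "('a \<Rightarrow> 'a \<Rightarrow> bool) \<Rightarrow> ('a \<Rightarrow> 'c set) \<Rightarrow> 'a set \<Rightarrow> 'a set \<Rightarrow> ('a \<Rightarrow> 'c) \<Rightarrow> bool" where
  "pcf_except E L W D \<phi> \<longleftrightarrow> (\<forall>u\<in>W. \<forall>v\<in>W. E u v \<longrightarrow> \<phi> u \<noteq> \<phi> v) \<and>
     (\<forall>v\<in>W - D. nb E W v \<noteq> {} \<longrightarrow> has_unique_color (nb E W v) \<phi>) \<and> (\<forall>v\<in>W. \<phi> v \<in> L v)"

text \<open>Since neighborhoods are taken in the whole of \<open>W\<close>, the cycle is a component
  of the induced subgraph. It needs five different colors, which four-element lists fail to offer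
  when they are all equal.\<close>

definition tight_five_cycle :: "('a \<Rightarrow> 'a \<Rightarrow> bool) \<Rightarrow> ('a \<Rightarrow> 'c set) \<Rightarrow> 'a set \<Rightarrow> bool" where
  "tight_five_cycle E L W \<longleftrightarrow> (\<exists>a b c d e. distinct [a, b, c, d, e] \<and> {a, b, c, d, e} \<subseteq> W \<and>
     nb E W a = {e, b} \<and> nb E W b = {a, c} \<and> nb E W c = {b, d} \<and> nb E W d = {c, e} \<and>
     nb E W e = {d, a} \<and> (\<forall>v\<in>{a, b, c, d, e}. card (L v) = 4))"

text \<open>The lower bound on \<open>card (L v)\<close> also makes the lists finite, since it is
  positive.\<close>

definition list_ok :: "('a \<Rightarrow> 'a \<Rightarrow> bool) \<Rightarrow> ('a \<Rightarrow> 'c set) \<Rightarrow> 'a set \<Rightarrow> bool" where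
  "list_ok E L W \<longleftrightarrow> finite W \<and> \<not> tight_five_cycle E L W \<and>
     (\<forall>v\<in>W. card (nb E W v) \<le> 4 \<and> card (nb E W v) + 2 \<le> card (L v))"

section \<open>Unique colors and extension of partial colorings\<close>

lemma has_unique_color_cong:
  "(\<And>a. a \<in> A \<Longrightarrow> \<phi> a = \<psi> a) \<Longrightarrow> has_unique_color A \<phi> \<longleftrightarrow> has_unique_color A \<psi>"
  by (auto simp: has_unique_color_def)

lemma has_unique_colorI:
  "u \<in> A \<Longrightarrow> (\<And>v. v \<in> A \<Longrightarrow> v \<noteq> u \<Longrightarrow> \<phi> v \<noteq> \<phi> u) \<Longrightarrow> has_unique_color A \<phi>"
  by (auto simp: has_unique_color_def)

lemma has_unique_color_pair: "\<phi> a \<noteq> \<phi> b \<Longrightarrow> has_unique_color {a, b} \<phi>"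
  by (auto simp: has_unique_color_def)

text \<open>Whatever the color of \<open>p\<close>, it repeats at most one of the two different
  colors, and the other one is unique. So \<open>p\<close> can be ignored.\<close>

lemma has_unique_color_triple: "\<phi> a \<noteq> \<phi> b \<Longrightarrow> has_unique_color {a, b, p} \<phi>"
  by (cases "\<phi> p = \<phi> a") (rule has_unique_colorI[of b], auto, rule has_unique_colorI[of a], auto)

text \<open>This is where the bound 4 on the degree enters: a multiset of at most three colors without a
  color of multiplicity one consists of copies of a single color.\<close>
lemma ex_forbidden_color:
  assumes "finite M" "card M \<le> 3"
  shows "\<exists>f. \<forall>\<psi>. (\<forall>m\<in>M. \<psi> m = \<phi> m) \<longrightarrow> \<psi> s \<noteq> f \<longrightarrow> has_unique_color (insert s M) \<psi>"
proof (cases "M = {} \<or> has_unique_color M \<phi>")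
  case True
  then show ?thesis
  proof
    assume "has_unique_color M \<phi>"
    \<comment> \<open>A color that is unique on \<open>M\<close> remains so unless the new vertex
      repeats it; it is the forbidden color.\<close>
    then obtain u where "u \<in> M" "\<And>v. v \<in> M \<Longrightarrow> \<phi> v = \<phi> u \<Longrightarrow> v = u"
      by (auto simp: has_unique_color_def)
    then show ?thesis
      by (intro exI[of _ "\<phi> u"] allI impI has_unique_colorI[of u]) auto
  qed (auto simp: has_unique_color_def)
next
  case False
  then obtain m where m: "m \<in> M" by auto
  have twin: "\<exists>v\<in>M. v \<noteq> u \<and> \<phi> v = \<phi> u" if "u \<in> M" for u
    using False that by (auto simp: has_unique_color_def)
  have same: "\<phi> v = \<phi> m" if v: "v \<in> M" for v
  proof (rule ccontr)
    assume "\<phi> v \<noteq> \<phi> m"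
    moreover obtain v' m' where "v' \<in> M" "v' \<noteq> v" "\<phi> v' = \<phi> v" "m' \<in> M" "m' \<noteq> m" "\<phi> m' = \<phi> m"
      using twin v m by meson
    moreover from calculation have "v \<noteq> m" "v \<noteq> m'" "v' \<noteq> m" "v' \<noteq> m'" by auto
    ultimately have "card {v, v', m, m'} = 4" "{v, v', m, m'} \<subseteq> M" using v m by auto
    then show False using card_mono[OF assms(1), of "{v, v', m, m'}"] assms(2) by simp
  qed
  show ?thesis
  proof (intro exI[of _ "\<phi> m"] allI impI)
    fix \<psi> assume "\<forall>m\<in>M. \<psi> m = \<phi> m" "\<psi> s \<noteq> \<phi> m"
    then show "has_unique_color (insert s M) \<psi>"
      using same by (intro has_unique_colorI[of s]) auto
  qed
qed

text \<open>Greedy: when entry \<open>i\<close> of the list is colored, only \<open>i\<close> colors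
  are in use.\<close>

lemma ex_distinct_representatives:
  assumes "distinct vs" "\<And>i. i < length vs \<Longrightarrow> i < card (L (vs ! i))"
  shows "\<exists>\<psi>. inj_on \<psi> (set vs) \<and> (\<forall>v\<in>set vs. \<psi> v \<in> L v)"
  using assms
proof (induction vs rule: rev_induct)
  case (snoc v vs)
  have "i < card (L (vs ! i))" if "i < length vs" for i
    using snoc.prems(2)[of i] that by (simp add: nth_append)
  then obtain \<psi> where \<psi>: "inj_on \<psi> (set vs)" "\<forall>v\<in>set vs. \<psi> v \<in> L v"
    using snoc.IH snoc.prems(1) by auto
  obtain c where "c \<in> L v" "c \<notin> set (map \<psi> vs)"
    using ex_notin_if_card_gt[of "map \<psi> vs" "L v"] snoc.prems(2)[of "length vs"] by auto
  then have "inj_on (\<psi>(v := c)) (set (vs @ [v])) \<and> (\<forall>u\<in>set (vs @ [v]). (\<psi>(v := c)) u \<in> L u)"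
    using \<psi> snoc.prems(1) by (auto simp: inj_on_def)
  then show ?case by blast
qed simp

text \<open>The square of a path with four vertices is \<open>K\<^sub>4\<close> minus an edge, which is list colorable from
  lists as large as the degrees.\<close>
lemma ex_path_square_coloring:
  assumes "2 \<le> card A1" "3 \<le> card A2" "3 \<le> card A3" "2 \<le> card A4"
  shows "\<exists>c1\<in>A1. \<exists>c2\<in>A2. \<exists>c3\<in>A3. \<exists>c4\<in>A4. c1 \<noteq> c2 \<and> c1 \<noteq> c3 \<and> c2 \<noteq> c3 \<and> c2 \<noteq> c4 \<and> c3 \<noteq> c4"
proof -
  have fin: "finite A1" "finite A2" "finite A3" "finite A4"
    using assms by (auto intro: card_ge_0_finite)
  \<comment> \<open>The ends are the only pair that may share a color. They are chosen so that two
    colors of \<open>A2\<close> remain; then \<open>c3\<close> is chosen, and \<open>c2\<close>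
    last.\<close>
  have "\<exists>c1\<in>A1. \<exists>c4\<in>A4. 2 \<le> card (A2 - {c1, c4})"
  proof (cases "A1 \<inter> A4 = {}")
    case False
    then obtain c where "c \<in> A1" "c \<in> A4" by blast
    moreover have "2 \<le> card (A2 - {c, c})" using assms(2) fin by (auto simp: card_Diff_singleton_if)
    ultimately show ?thesis by blast
  next
    case True
    obtain c1 c4 where c: "c1 \<in> A1" "c4 \<in> A4" using assms by (metis card.empty equals0I not_numeral_le_zero)
    show ?thesis
    proof (cases "A1 \<union> A4 \<subseteq> A2")
      case sub: True
      have "card (A1 \<union> A4) = card A1 + card A4" using True fin by (simp add: card_Un_disjoint)
      then have "4 \<le> card A2" using card_mono[OF fin(2) sub] assms by simp
      then have "2 \<le> card (A2 - {c1, c4})"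
        using diff_card_le_card_Diff[of "{c1, c4}" A2] by (auto simp: card_insert_if split: if_splits)
      then show ?thesis using c by blast
    next
      case False
      have one: "2 \<le> card (A2 - {a, b})" if "a \<notin> A2 \<or> b \<notin> A2" for a b
      proof -
        have "A2 - {a, b} = A2 - {a} \<or> A2 - {a, b} = A2 - {b}" using that by auto
        moreover have "2 \<le> card (A2 - {z})" for z
          using assms(2) fin by (auto simp: card_Diff_singleton_if)
        ultimately show ?thesis by (elim disjE) (simp_all only:)
      qed
      from False consider a where "a \<in> A1" "a \<notin> A2" | a where "a \<in> A4" "a \<notin> A2" by blast
      then show ?thesis using one c by cases blast+
    qed
  qed
  then obtain c1 c4 where c: "c1 \<in> A1" "c4 \<in> A4" "2 \<le> card (A2 - {c1, c4})" by blast
  obtain c3 where c3: "c3 \<in> A3" "c3 \<notin> {c1, c4}" using ex_notin_if_card_gt[of "[c1, c4]" A3] assms(3) by auto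
  obtain c2 where "c2 \<in> A2 - {c1, c4}" "c2 \<noteq> c3" using ex_notin_if_card_gt[of "[c3]" "A2 - {c1, c4}"] c(3) by auto
  with c c3 show ?thesis
    by (intro bexI[of _ c1] bexI[of _ c2] bexI[of _ c3] bexI[of _ c4]) auto
qed

text \<open>By the last assumption every old vertex whose neighborhood grows is postponed, so the
  other old vertices keep their condition unchanged.\<close>

lemma pcf_except_extend:
  assumes "pcf_except E L W D \<phi>" "sgraph E" "I \<inter> W = {}" "\<And>w. w \<in> W \<Longrightarrow> \<psi> w = \<phi> w"
    and "\<And>s. s \<in> I \<Longrightarrow> \<psi> s \<in> L s"
    and "\<And>s u. s \<in> I \<Longrightarrow> u \<in> nb E (W \<union> I) s \<Longrightarrow> \<psi> u \<noteq> \<psi> s"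
    and "\<And>s. s \<in> I - D \<Longrightarrow> has_unique_color (nb E (W \<union> I) s) \<psi>"
    and "\<And>s. s \<in> I \<Longrightarrow> nb E W s \<subseteq> D"
  shows "pcf_except E L (W \<union> I) D \<psi>"
proof -
  interpret sgraph E by fact
  have "\<psi> u \<noteq> \<psi> v" if "u \<in> W \<union> I" "v \<in> W \<union> I" "E u v" for u v
  proof (cases "u \<in> I \<or> v \<in> I")
    case True
    then show ?thesis using assms(6)[of u v] assms(6)[of v u] that sym by (auto simp: nb_def)
  next
    case False
    then show ?thesis using assms(1,4) that by (auto simp: pcf_except_def)
  qed
  moreover have "has_unique_color (nb E (W \<union> I) v) \<psi>"
    if v: "v \<in> (W \<union> I) - D" and ne: "nb E (W \<union> I) v \<noteq> {}" for v
  proof (cases "v \<in> I")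
    case True
    then show ?thesis using assms(7) v by simp
  next
    case False
    have "nb E (W \<union> I) v = nb E W v"
      using assms(8) v False sym by (fastforce simp: nb_def)
    moreover have "has_unique_color (nb E W v) \<psi> \<longleftrightarrow> has_unique_color (nb E W v) \<phi>"
      by (intro has_unique_color_cong assms(4)) (simp add: nb_def)
    ultimately show ?thesis using assms(1) v False ne by (auto simp: pcf_except_def)
  qed
  moreover have "\<psi> v \<in> L v" if "v \<in> W \<union> I" for v
    using that assms(1,4,5) by (auto simp: pcf_except_def)
  ultimately show ?thesis by (auto simp: pcf_except_def)
qed

lemma pcf_except_mono: "pcf_except E L W D \<phi> \<Longrightarrow> D \<subseteq> D' \<Longrightarrow> pcf_except E L W D' \<phi>"
  by (auto simp: pcf_except_def)

lemma pcf_except_finish: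
  assumes "pcf_except E L W D \<phi>" "\<And>v. v \<in> D - D' \<Longrightarrow> v \<in> W \<Longrightarrow> nb E W v \<noteq> {} \<Longrightarrow> has_unique_color (nb E W v) \<phi>"
  shows "pcf_except E L W D' \<phi>"
proof -
  have "has_unique_color (nb E W v) \<phi>" if "v \<in> W - D'" "nb E W v \<noteq> {}" for v
    using assms that by (cases "v \<in> D") (auto simp: pcf_except_def)
  then show ?thesis using assms(1) by (simp add: pcf_except_def)
qed

text \<open>Lists may change only at vertices with three remaining neighbors. The vertices of a
  tight five-cycle in \<open>W\<close> thus have their old lists of size 4, hence had at most two
  neighbors in \<open>V\<close> and lost none: the cycle was tight in \<open>V\<close>
  already.\<close>

lemma list_ok_subset:
  assumes ok: "list_ok E L V" and W: "W \<subseteq> V"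
    and L': "\<And>v. v \<in> W \<Longrightarrow> L' v = L v \<or> 3 \<le> card (nb E W v) \<and> card (nb E W v) + 2 \<le> card (L' v)"
  shows "list_ok E L' W"
proof -
  have sub: "nb E W v \<subseteq> nb E V v" for v using W by (auto simp: nb_def)
  have finN: "finite (nb E V v)" for v
    using ok nb_subset[of E V v] finite_subset by (auto simp: list_ok_def)
  have le: "card (nb E W v) \<le> card (nb E V v)" for v using card_mono[OF finN sub] .
  have eq: "nb E V v = nb E W v \<and> card (L v) = 4" if "v \<in> W" "card (nb E W v) = 2" "card (L' v) = 4" for v
  proof -
    have "L' v = L v" using L'[OF that(1)] that by auto
    moreover have "card (nb E V v) + 2 \<le> card (L v)" using ok that(1) W by (auto simp: list_ok_def)
    ultimately have "card (nb E V v) \<le> 2" using that by simp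
    then show ?thesis using card_seteq[OF finN sub[of v]] that \<open>L' v = L v\<close> by auto
  qed
  have "card (nb E W v) \<le> 4 \<and> card (nb E W v) + 2 \<le> card (L' v)" if "v \<in> W" for v
    using ok that W le[of v] L'[OF that] unfolding list_ok_def by fastforce
  moreover have "\<not> tight_five_cycle E L' W"
  proof
    have key: "nb E V v = nb E W v \<and> card (L v) = 4"
      if "v \<in> W" "nb E W v = {x, y}" "x \<noteq> y" "card (L' v) = 4" for v x y
      using that by (intro eq) auto
    assume "tight_five_cycle E L' W"
    then obtain a b c d e where dist: "distinct [a, b, c, d, e]" and sub: "{a, b, c, d, e} \<subseteq> W"
      and "nb E W a = {e, b}" "nb E W b = {a, c}" "nb E W c = {b, d}" "nb E W d = {c, e}"
      "nb E W e = {d, a}" "\<forall>v\<in>{a, b, c, d, e}. card (L' v) = 4"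
      unfolding tight_five_cycle_def by (elim exE conjE)
    then have "nb E V a = {e, b} \<and> card (L a) = 4" "nb E V b = {a, c} \<and> card (L b) = 4"
      "nb E V c = {b, d} \<and> card (L c) = 4" "nb E V d = {c, e} \<and> card (L d) = 4"
      "nb E V e = {d, a} \<and> card (L e) = 4"
      using key[of a e b] key[of b a c] key[of c b d] key[of d c e] key[of e d a] by auto
    moreover have "{a, b, c, d, e} \<subseteq> V" using sub W by (rule subset_trans)
    ultimately have *: "distinct [a, b, c, d, e] \<and> {a, b, c, d, e} \<subseteq> V \<and>
        nb E V a = {e, b} \<and> nb E V b = {a, c} \<and> nb E V c = {b, d} \<and> nb E V d = {c, e} \<and>
        nb E V e = {d, a} \<and> (\<forall>v\<in>{a, b, c, d, e}. card (L v) = 4)"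
      using dist by simp
    have "tight_five_cycle E L V"
      unfolding tight_five_cycle_def
      by (rule exI[of _ a], rule exI[of _ b], rule exI[of _ c], rule exI[of _ d], rule exI[of _ e], rule *)
    then show False using ok by (simp add: list_ok_def)
  qed
  ultimately show ?thesis
    using ok W finite_subset unfolding list_ok_def by blast
qed

text \<open>Minimality holds for all admissible lists on a smaller set, not just for
  \<open>L\<close>; \<open>three_thread_lists\<close> uses it with a reduced list.\<close>

locale min_counterexample = sgraph E for E :: "'a \<Rightarrow> 'a \<Rightarrow> bool" +
  fixes L :: "'a \<Rightarrow> 'c set" and V :: "'a set"
  assumes ok: "list_ok E L V"
    and no_coloring: "\<not> pcf_except E L V {} \<phi>"
    and smaller: "W \<subset> V \<Longrightarrow> list_ok E L' W \<Longrightarrow> \<exists>\<phi> :: 'a \<Rightarrow> 'c. pcf_except E L' W {} \<phi>"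
begin

abbreviation N :: "'a \<Rightarrow> 'a set" where "N \<equiv> nb E V"

lemma finV: "finite V" using ok by (simp add: list_ok_def)

lemma finN: "finite (N v)" using finite_subset[OF nb_subset finV] .

lemma N_le_4: "v \<in> V \<Longrightarrow> card (N v) \<le> 4" using ok by (simp add: list_ok_def)

lemma card_L: "v \<in> V \<Longrightarrow> card (N v) + 2 \<le> card (L v)" using ok by (simp add: list_ok_def)

lemma in_N_iff: "u \<in> N v \<longleftrightarrow> u \<in> V \<and> E v u" by (simp add: nb_def)

lemma N_sym: "v \<in> V \<Longrightarrow> u \<in> N v \<Longrightarrow> v \<in> N u" by (auto simp: nb_def intro: sym)

lemma N_irrefl: "v \<notin> N v" by (simp add: nb_def irr)

lemma nb_Diff: "nb E (V - S) v = N v - S" by (auto simp: nb_def)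

lemma ex_smaller:
  assumes "W \<subset> V"
  shows "\<exists>\<phi>. pcf_except E L W {} \<phi>"
proof (rule smaller[OF assms])
  show "list_ok E L W" using assms by (intro list_ok_subset[OF ok]) auto
qed

lemma ex_forbidden:
  assumes "u \<in> V" "s \<in> N u"
  shows "\<exists>f. \<forall>\<psi>. (\<forall>m\<in>N u - {s}. \<psi> m = \<phi> m) \<longrightarrow> \<psi> s \<noteq> f \<longrightarrow> has_unique_color (N u) \<psi>"
proof -
  have "card (N u - {s}) \<le> 3" using N_le_4[OF assms(1)] assms(2) finN by simp
  from ex_forbidden_color[OF _ this, of \<phi> s] show ?thesis using finN assms(2) by (simp add: insert_absorb)
qed

text \<open>The common end of the reducibility proofs: \<open>S\<close> is the deleted set and
  \<open>D\<close> contains its neighbors outside. Exactly there a neighborhood may have changed, so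
  only there unique colors are to be checked.\<close>

lemma no_extension:
  assumes "pcf_except E L (V - S) D \<phi>" "S \<subseteq> V" "\<And>v. v \<in> V - S \<Longrightarrow> \<psi> v = \<phi> v"
    and "\<And>s. s \<in> S \<Longrightarrow> \<psi> s \<in> L s"
    and "\<And>s u. s \<in> S \<Longrightarrow> u \<in> N s \<Longrightarrow> \<psi> u \<noteq> \<psi> s"
    and "\<And>v. v \<in> S \<union> D \<Longrightarrow> v \<in> V \<Longrightarrow> N v \<noteq> {} \<Longrightarrow> has_unique_color (N v) \<psi>"
    and "\<And>s. s \<in> S \<Longrightarrow> N s \<subseteq> S \<union> D"
  shows False
proof -
  \<comment> \<open>Below, isolated vertices of \<open>S\<close> are postponed as well: they have no
    unique color, and they disappear again in the final step, where empty neighborhoods are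
    exempt.\<close>
  have eq: "V - S \<union> S = V" using assms(2) by auto
  have "pcf_except E L (V - S \<union> S) (D \<union> {s\<in>S. N s = {}}) \<psi>"
  proof (rule pcf_except_extend[where W = "V - S" and \<phi> = \<phi>, OF _ sgraph_axioms])
    show "pcf_except E L (V - S) (D \<union> {s\<in>S. N s = {}}) \<phi>"
      using assms(1) by (rule pcf_except_mono) simp
    show "nb E (V - S) s \<subseteq> D \<union> {s\<in>S. N s = {}}" if "s \<in> S" for s
      using assms(7)[OF that] by (auto simp: nb_Diff)
    show "has_unique_color (nb E (V - S \<union> S) s) \<psi>" if "s \<in> S - (D \<union> {s\<in>S. N s = {}})" for s
      using assms(2,6) that unfolding eq by auto
  qed (use assms(3-5) eq in auto)
  then have "pcf_except E L V {} \<psi>"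
    unfolding eq by (rule pcf_except_finish) (use assms(6) in blast)
  then show False using no_coloring by blast
qed

text \<open>For degree 1 the plain count works: three colors against the color of the neighbor and
  its harmful color.\<close>

lemma degree_ge_2:
  assumes v: "v \<in> V"
  shows "2 \<le> card (N v)"
proof (rule ccontr)
  assume "\<not> ?thesis"
  then have le: "card (N v) \<le> 1" by simp
  obtain \<phi> where \<phi>: "pcf_except E L (V - {v}) {} \<phi>" using ex_smaller[of "V - {v}"] v by auto
  show False
  proof (cases "N v = {}")
    case True
    obtain c where "c \<in> L v" using ex_notin_if_card_gt[of "[]" "L v"] card_L[OF v] by auto
    then show False
      by (intro no_extension[of "{v}" "{}" \<phi> "\<phi>(v := c)"]) (use \<phi> v True in auto)
  next
    case False
    then have "card (N v) = 1" using le finN by (metis card_0_eq le_antisym less_one not_le)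
    then obtain u where u: "N v = {u}" by (auto simp: card_1_singleton_iff)
    then have uV: "u \<in> V" "u \<noteq> v" using in_N_iff N_irrefl by auto
    have vu: "v \<in> N u" using N_sym[OF v] u by simp
    obtain f where f: "\<forall>\<psi>. (\<forall>m\<in>N u - {v}. \<psi> m = \<phi> m) \<longrightarrow> \<psi> v \<noteq> f \<longrightarrow> has_unique_color (N u) \<psi>"
      using ex_forbidden[OF uV(1) vu, of \<phi>] ..
    obtain c where c: "c \<in> L v" "c \<notin> {\<phi> u, f}"
      using ex_notin_if_card_gt[of "[\<phi> u, f]" "L v"] card_L[OF v] u by auto
    show False
      by (rule no_extension[of "{v}" "{u}" \<phi> "\<phi>(v := c)"])
        (use \<phi> v u uV c f in \<open>auto intro: pcf_except_mono simp: has_unique_color_def[of "{u}"]\<close>)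
  qed
qed

text \<open>The edge already makes \<open>x\<close> and \<open>y\<close> differ, which settles
  \<open>v\<close>. Since \<open>v\<close> differs from \<open>y\<close>, and \<open>x\<close> has
  at most one further neighbor, \<open>x\<close> is settled too, and only \<open>y\<close>
  contributes a harmful color.\<close>

lemma no_triangle:
  assumes v: "v \<in> V" "N v = {x, y}" and xy: "E x y" and dx: "card (N x) \<le> 3"
  shows False
proof -
  have V: "x \<in> V" "y \<in> V" "x \<noteq> v" "y \<noteq> v" "x \<noteq> y"
    using v xy in_N_iff[of x v] in_N_iff[of y v] N_irrefl[of v] irr by auto
  obtain \<phi> where \<phi>: "pcf_except E L (V - {v}) {} \<phi>" using ex_smaller[of "V - {v}"] v by auto
  have neq: "\<phi> x \<noteq> \<phi> y" using \<phi> V xy by (auto simp: pcf_except_def)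
  have vN: "v \<in> N x" "v \<in> N y" using N_sym[OF v(1)] v(2) by auto
  obtain f where f: "\<forall>\<psi>. (\<forall>m\<in>N y - {v}. \<psi> m = \<phi> m) \<longrightarrow> \<psi> v \<noteq> f \<longrightarrow> has_unique_color (N y) \<psi>"
    using ex_forbidden[OF V(2) vN(2), of \<phi>] ..
  obtain c where c: "c \<in> L v" "c \<notin> {\<phi> x, \<phi> y, f}"
    using ex_notin_if_card_gt[of "[\<phi> x, \<phi> y, f]" "L v"] card_L[OF v(1)] V(5) v by auto
  have "y \<in> N x" using V xy by (simp add: in_N_iff)
  then have "card (N x - {v, y}) \<le> 1" using dx vN(1) V finN by (subst card_Diff_subset) auto
  then obtain p where "N x - {v, y} \<subseteq> {p}"
    using finN by (metis card_1_singleton_iff card_0_eq empty_subsetI finite_Diff le_Suc_eq le_zero_eq subset_refl One_nat_def)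
  then have "N x = {v, y} \<or> N x = {v, y, p}" using vN \<open>y \<in> N x\<close> by auto
  then have Nx: "has_unique_color (N x) (\<phi>(v := c))"
    using has_unique_color_triple[of "\<phi>(v := c)" v y] has_unique_color_pair[of "\<phi>(v := c)" v y] c V by auto
  show False
    by (rule no_extension[of "{v}" "{x, y}" \<phi> "\<phi>(v := c)"])
      (use \<phi> v V c f Nx neq in \<open>auto intro: pcf_except_mono simp: has_unique_color_pair\<close>)
qed

end

section \<open>Reducible configurations of 2-vertices\<close>

lemma card_Diff_set_ge: "n + length xs \<le> card A \<Longrightarrow> n \<le> card (A - set xs)"
  using diff_card_le_card_Diff[of "set xs" A] card_length[of xs] by simp

lemma pcf_except_remove:
  assumes "sgraph E" "pcf_except E L W D \<phi>"
  shows "pcf_except E L (W - {v}) (D \<union> nb E W v) \<phi>"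
proof -
  interpret sgraph E by fact
  have "nb E (W - {v}) u = nb E W u" if "u \<in> W" "u \<notin> nb E W v" for u
    using that by (auto simp: nb_def intro: sym)
  then show ?thesis using assms(2) by (auto simp: pcf_except_def)
qed

lemma pcf_exceptD:
  "pcf_except E L W D \<phi> \<Longrightarrow> v \<in> W - D \<Longrightarrow> nb E W v = A \<Longrightarrow> A \<noteq> {} \<Longrightarrow> has_unique_color A \<phi>"
  unfolding pcf_except_def by blast

context min_counterexample
begin

lemma N_pair_neq: "v \<in> V \<Longrightarrow> N v = {x, y} \<Longrightarrow> x \<noteq> y"
  using degree_ge_2[of v] by auto

lemma N_pairD:
  assumes "v \<in> V" "N v = {x, y}"
  shows "x \<in> V" "y \<in> V" "v \<in> N x" "v \<in> N y" "x \<noteq> v" "y \<noteq> v" "4 \<le> card (L v)" "x \<noteq> y"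
  using N_pair_neq[OF assms] N_sym[OF assms(1)] N_irrefl[of v] card_L[OF assms(1)] assms in_N_iff[of _ v]
  by auto

text \<open>The conflict-free condition at \<open>x\<close> in the smaller graph, where just two
  neighbors are left, says that these differ.\<close>

lemma colors_of_remaining_pair:
  assumes \<phi>: "pcf_except E L (V - S) {} \<phi>" and x: "x \<in> V - S" and c: "card (N x - S) = 2"
  shows "\<exists>p q. N x - S = {p, q} \<and> \<phi> p \<noteq> \<phi> q \<and> p \<notin> S \<and> q \<notin> S"
proof -
  obtain p q where pq: "N x - S = {p, q}" "p \<noteq> q" using c by (auto simp: card_2_iff)
  have "has_unique_color {p, q} \<phi>"
    by (rule pcf_exceptD[OF \<phi>]) (use x pq in \<open>auto simp: nb_Diff\<close>)
  then have "\<phi> p \<noteq> \<phi> q" using pq(2) by (auto simp: has_unique_color_def)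
  moreover have "p \<notin> S" "q \<notin> S" using pq(1) by blast+
  ultimately show ?thesis using pq(1) by blast
qed

text \<open>The two other neighbors of \<open>x\<close> differ in color, so \<open>x\<close> is
  settled whatever \<open>u\<close> receives. Without a harmful color for \<open>x\<close>, each of
  \<open>v\<close> and then \<open>u\<close> avoids only three colors.\<close>

lemma no_thread_at_degree_3:
  assumes u: "u \<in> V" "N u = {x, v}" and v: "v \<in> V" "N v = {u, w}" and xw: "x \<noteq> w" and dx: "card (N x) = 3"
  shows False
proof -
  note Nu = N_pairD[OF u] and Nv = N_pairD[OF v]
  obtain \<phi> where \<phi>: "pcf_except E L (V - {u, v}) {} \<phi>" using ex_smaller[of "V - {u, v}"] u by auto
  have vx: "v \<notin> N x" using N_sym[of x v] Nu v xw by auto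
  have uw: "u \<notin> N w" using N_sym[of w u] Nv u xw by auto
  have eq: "N x - {u, v} = N x - {u}" using vx by auto
  have c2: "card (N x - {u, v}) = 2" unfolding eq using dx Nu finN by simp
  have "x \<in> V - {u, v}" using Nu by simp
  from colors_of_remaining_pair[OF \<phi> this c2] obtain p q where
    pq: "N x - {u, v} = {p, q}" "\<phi> p \<noteq> \<phi> q" "p \<notin> {u, v}" "q \<notin> {u, v}" by blast
  have Nx: "N x = {p, q, u}" using pq(1) Nu vx by auto
  obtain f where f: "\<forall>\<psi>. (\<forall>m\<in>N w - {v}. \<psi> m = \<phi> m) \<longrightarrow> \<psi> v \<noteq> f \<longrightarrow> has_unique_color (N w) \<psi>"
    using ex_forbidden[OF Nv(2,4), of \<phi>] ..
  obtain cv where cv: "cv \<in> L v" "cv \<notin> {\<phi> x, \<phi> w, f}"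
    using ex_notin_if_card_gt[of "[\<phi> x, \<phi> w, f]" "L v"] Nv by auto
  obtain cu where cu: "cu \<in> L u" "cu \<notin> {\<phi> x, \<phi> w, cv}"
    using ex_notin_if_card_gt[of "[\<phi> x, \<phi> w, cv]" "L u"] Nu by auto
  let ?\<psi> = "\<phi>(u := cu, v := cv)"
  have "has_unique_color (N x) ?\<psi>"
    unfolding Nx using pq by (intro has_unique_color_triple) auto
  moreover have "has_unique_color (N w) ?\<psi>" using f uw cv Nv by auto
  moreover have "has_unique_color (N u) ?\<psi>" "has_unique_color (N v) ?\<psi>"
    using u v Nu Nv cu cv by (auto simp: has_unique_color_pair)
  ultimately show False
    using \<phi> u v Nu Nv cu cv
    by (intro no_extension[of "{u, v}" "{x, w}" \<phi> ?\<psi>]) (auto intro: pcf_except_mono)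
qed

text \<open>Only \<open>v'\<close> is deleted at first, since the remaining twin forces
  \<open>x\<close> and \<open>y\<close> to differ. Then both twins are colored anew:
  \<open>v\<close> differs from the third neighbor \<open>t\<close> of \<open>x\<close>, which
  settles \<open>x\<close>, and \<open>v'\<close> settles \<open>y\<close>.\<close>

lemma no_twins_at_degree_3:
  assumes v: "v \<in> V" "N v = {x, y}" and v': "v' \<in> V" "N v' = {x, y}" and neq: "v \<noteq> v'" and dx: "card (N x) = 3"
  shows False
proof -
  note Nv = N_pairD[OF v] and Nv' = N_pairD[OF v']
  obtain \<phi> where \<phi>: "pcf_except E L (V - {v'}) {} \<phi>" using ex_smaller[of "V - {v'}"] v' by auto
  have Nv_W: "nb E (V - {v'}) v = {x, y}" using v Nv' by (auto simp: nb_Diff)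
  then have "has_unique_color {x, y} \<phi>" using v neq by (intro pcf_exceptD[OF \<phi>]) auto
  then have xy: "\<phi> x \<noteq> \<phi> y" using Nv by (auto simp: has_unique_color_def)
  have \<phi>': "pcf_except E L (V - {v, v'}) {x, y} \<phi>"
  proof -
    have "V - {v'} - {v} = V - {v, v'}" by auto
    then show ?thesis using pcf_except_remove[OF sgraph_axioms \<phi>, of v] Nv_W by simp
  qed
  have "card (N x - {v, v'}) = 1" using dx Nv Nv' neq finN by (subst card_Diff_subset) auto
  then obtain t where t: "N x - {v, v'} = {t}" by (auto simp: card_1_singleton_iff)
  then have Nx: "N x = {v, t, v'}" "t \<notin> {v, v'}" using Nv Nv' by auto
  obtain c where c: "c \<in> L v" "c \<notin> {\<phi> x, \<phi> y, \<phi> t}"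
    using ex_notin_if_card_gt[of "[\<phi> x, \<phi> y, \<phi> t]" "L v"] Nv by auto
  obtain f where f: "\<forall>\<psi>. (\<forall>m\<in>N y - {v'}. \<psi> m = (\<phi>(v := c)) m) \<longrightarrow> \<psi> v' \<noteq> f \<longrightarrow> has_unique_color (N y) \<psi>"
    using ex_forbidden[OF Nv'(2,4), of "\<phi>(v := c)"] ..
  obtain c' where c': "c' \<in> L v'" "c' \<notin> {\<phi> x, \<phi> y, f}"
    using ex_notin_if_card_gt[of "[\<phi> x, \<phi> y, f]" "L v'"] Nv' by auto
  let ?\<psi> = "\<phi>(v := c, v' := c')"
  have "has_unique_color (N x) ?\<psi>"
    unfolding Nx(1) using Nx(2) c neq by (intro has_unique_color_triple) auto
  moreover have "has_unique_color (N y) ?\<psi>" using f c' by auto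
  moreover have "has_unique_color (N v) ?\<psi>" "has_unique_color (N v') ?\<psi>"
    using v v' Nv Nv' xy by (auto simp: has_unique_color_pair)
  ultimately show False
    using \<phi>' v v' Nv Nv' c c'
    by (intro no_extension[of "{v, v'}" "{x, y}" \<phi> ?\<psi>]) (auto intro: pcf_except_mono)
qed

text \<open>The color of \<open>a\<close> is made the unique one around \<open>x\<close>, so
  \<open>c\<close> and \<open>b\<close> have no harmful color to avoid.\<close>

lemma no_pendant_four_cycle:
  assumes a: "a \<in> V" "N a = {x, b}" and b: "b \<in> V" "N b = {a, c}" and c: "c \<in> V" "N c = {b, x}"
    and dx: "card (N x) = 4"
  shows False
proof -
  note Na = N_pairD[OF a] and Nb = N_pairD[OF b] and Nc = N_pairD[OF c]
  obtain \<phi> where \<phi>: "pcf_except E L (V - {a, b, c}) {} \<phi>" using ex_smaller[of "V - {a, b, c}"] a by auto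
  have bx: "b \<notin> N x" using N_sym[of x b] Na b Nb Nc by auto
  have eq: "N x - {a, b, c} = N x - {a, c}" using bx by auto
  have c2: "card (N x - {a, b, c}) = 2"
    unfolding eq using dx Na Nb Nc finN by (subst card_Diff_subset) auto
  have "x \<in> V - {a, b, c}" using Na Nb Nc by auto
  from colors_of_remaining_pair[OF \<phi> this c2] obtain p q where
    pq: "N x - {a, b, c} = {p, q}" "p \<notin> {a, b, c}" "q \<notin> {a, b, c}" by blast
  have Nx: "N x = {a, c, p, q}" using pq(1) Na Nc bx by auto
  obtain c1 where c1: "c1 \<in> L a" "c1 \<notin> {\<phi> x, \<phi> p, \<phi> q}"
    using ex_notin_if_card_gt[of "[\<phi> x, \<phi> p, \<phi> q]" "L a"] Na by auto
  obtain c3 where c3: "c3 \<in> L c" "c3 \<notin> {\<phi> x, c1}"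
    using ex_notin_if_card_gt[of "[\<phi> x, c1]" "L c"] Nc by auto
  obtain c2 where c2: "c2 \<in> L b" "c2 \<notin> {\<phi> x, c1, c3}"
    using ex_notin_if_card_gt[of "[\<phi> x, c1, c3]" "L b"] Nb by auto
  let ?\<psi> = "\<phi>(a := c1, b := c2, c := c3)"
  have "has_unique_color (N x) ?\<psi>"
    unfolding Nx using pq(2,3) c1 c3 Na Nb Nc by (intro has_unique_colorI[of a]) auto
  moreover have "has_unique_color (N a) ?\<psi>" "has_unique_color (N b) ?\<psi>" "has_unique_color (N c) ?\<psi>"
    unfolding a(2) b(2) c(2)
    by (rule has_unique_color_pair; use Na Nb Nc c1 c2 c3 in auto)+
  ultimately show False
    using \<phi> a b c Na Nb Nc c1 c2 c3
    by (intro no_extension[of "{a, b, c}" "{x}" \<phi> ?\<psi>]) (auto intro: pcf_except_mono)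
qed

lemma no_four_cycle:
  assumes a: "a \<in> V" "N a = {d, b}" and b: "b \<in> V" "N b = {a, c}" and c: "c \<in> V" "N c = {b, d}"
    and d: "d \<in> V" "N d = {c, a}"
  shows False
proof -
  note Ns = N_pairD[OF a] N_pairD[OF b] N_pairD[OF c] N_pairD[OF d]
  let ?S = "{a, b, c, d}"
  obtain \<phi> where \<phi>: "pcf_except E L (V - ?S) {} \<phi>" using ex_smaller[of "V - ?S"] a by auto
  have "\<exists>\<psi>. inj_on \<psi> (set [a, b, c, d]) \<and> (\<forall>v\<in>set [a, b, c, d]. \<psi> v \<in> L v)"
    by (rule ex_distinct_representatives) (use Ns in \<open>auto simp: less_Suc_eq\<close>)
  then obtain \<psi> where \<psi>: "inj_on \<psi> ?S" "\<forall>v\<in>?S. \<psi> v \<in> L v" by auto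
  let ?\<psi> = "\<lambda>v. if v \<in> ?S then \<psi> v else \<phi> v"
  have neq: "?\<psi> u \<noteq> ?\<psi> v" if "u \<in> ?S" "v \<in> ?S" "u \<noteq> v" for u v
    using inj_onD[OF \<psi>(1), of u v] that by auto
  have "has_unique_color (N v) ?\<psi>" if "v \<in> ?S" for v
    using that a b c d Ns neq
    by (elim insertE) (simp_all only: has_unique_color_pair insertI1 insertI2 not_False_eq_True, auto)
  moreover have "?\<psi> u \<noteq> ?\<psi> s" if "s \<in> ?S" "u \<in> N s" for s u
    using that a b c d Ns by (intro neq) auto
  ultimately show False
    using \<phi> \<psi>(2) a b c d by (intro no_extension[of ?S "{}" \<phi> ?\<psi>]) auto
qed

text \<open>As the cycle is not tight, one list has five colors. Its vertex is colored last, and all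
  five colors can be made different.\<close>

lemma no_five_cycle:
  assumes a: "a \<in> V" "N a = {e, b}" and b: "b \<in> V" "N b = {a, c}" and c: "c \<in> V" "N c = {b, d}"
    and d: "d \<in> V" "N d = {c, e}" and e: "e \<in> V" "N e = {d, a}" and dist: "distinct [a, b, c, d, e]"
  shows False
proof -
  note Ns = N_pairD[OF a] N_pairD[OF b] N_pairD[OF c] N_pairD[OF d] N_pairD[OF e]
  let ?S = "{a, b, c, d, e}"
  obtain \<phi> where \<phi>: "pcf_except E L (V - ?S) {} \<phi>" using ex_smaller[of "V - ?S"] a by auto
  have "\<not> (\<forall>v\<in>?S. card (L v) = 4)"
  proof
    assume "\<forall>v\<in>?S. card (L v) = 4"
    then have *: "distinct [a, b, c, d, e] \<and> {a, b, c, d, e} \<subseteq> V \<and>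
        nb E V a = {e, b} \<and> nb E V b = {a, c} \<and> nb E V c = {b, d} \<and> nb E V d = {c, e} \<and>
        nb E V e = {d, a} \<and> (\<forall>v\<in>{a, b, c, d, e}. card (L v) = 4)"
      using a b c d e dist by simp
    have "tight_five_cycle E L V"
      unfolding tight_five_cycle_def
      by (rule exI[of _ a], rule exI[of _ b], rule exI[of _ c], rule exI[of _ d], rule exI[of _ e], rule *)
    then show False using ok by (simp add: list_ok_def)
  qed
  then obtain w where w: "w \<in> ?S" "card (L w) \<noteq> 4" by blast
  have L4: "4 \<le> card (L v)" if "v \<in> ?S" for v using that Ns by auto
  have w5: "5 \<le> card (L w)" using w L4[OF w(1)] by simp
  obtain vs where vs: "set vs = ?S - {w}" "distinct vs" using finite_distinct_list[of "?S - {w}"] by auto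
  have len: "length vs = 4" using vs w dist distinct_card[of vs] by (auto simp: card_insert_if)
  have "\<exists>\<psi>. inj_on \<psi> (set (vs @ [w])) \<and> (\<forall>v\<in>set (vs @ [w]). \<psi> v \<in> L v)"
  proof (rule ex_distinct_representatives)
    show "i < card (L ((vs @ [w]) ! i))" if "i < length (vs @ [w])" for i
    proof (cases "i < 4")
      case True
      then have "vs ! i \<in> set vs" using len by simp
      then have "vs ! i \<in> ?S" using vs(1) by blast
      from L4[OF this] show ?thesis using True len by (simp add: nth_append)
    next
      case False
      then have "i = 4" using that len by simp
      then show ?thesis using w5 len by (simp add: nth_append)
    qed
  qed (use vs in auto)
  moreover have "set (vs @ [w]) = ?S" using vs(1) w(1) by auto
  ultimately obtain \<psi> where \<psi>: "inj_on \<psi> ?S" "\<forall>v\<in>?S. \<psi> v \<in> L v" by metis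
  let ?\<psi> = "\<lambda>v. if v \<in> ?S then \<psi> v else \<phi> v"
  have neq: "?\<psi> u \<noteq> ?\<psi> v" if "u \<in> ?S" "v \<in> ?S" "u \<noteq> v" for u v
    using inj_onD[OF \<psi>(1), of u v] that by auto
  have "has_unique_color (N v) ?\<psi>" if v: "v \<in> ?S" for v
  proof -
    obtain p q where pq: "N v = {p, q}" "p \<in> ?S" "q \<in> ?S" "p \<noteq> q"
      using v a(2) b(2) c(2) d(2) e(2) dist by auto
    show ?thesis unfolding pq(1) by (rule has_unique_color_pair) (rule neq[OF pq(2-4)])
  qed
  moreover have "?\<psi> u \<noteq> ?\<psi> s" if "s \<in> ?S" "u \<in> N s" for s u
    using that a b c d e Ns by (intro neq) auto
  ultimately show False
    using \<phi> \<psi>(2) a b c d e by (intro no_extension[of ?S "{}" \<phi> ?\<psi>]) auto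
qed

text \<open>\<open>a\<close> avoids the colors of the two other neighbors \<open>p\<close> and
  \<open>q\<close> of \<open>x\<close>, which differ. Then \<open>d\<close> need not care about
  \<open>x\<close>: if it repeats the color of \<open>a\<close>, the color of \<open>p\<close> is
  unique, and otherwise that of \<open>a\<close> is.\<close>

lemma no_pendant_five_cycle:
  assumes a: "a \<in> V" "N a = {x, b}" and b: "b \<in> V" "N b = {a, c}" and c: "c \<in> V" "N c = {b, d}"
    and d: "d \<in> V" "N d = {c, x}" and dist: "distinct [a, b, c, d, x]" and dx: "card (N x) = 4"
  shows False
proof -
  note Na = N_pairD[OF a] and Nb = N_pairD[OF b] and Nc = N_pairD[OF c] and Nd = N_pairD[OF d]
  let ?S = "{a, b, c, d}"
  obtain \<phi> where \<phi>: "pcf_except E L (V - ?S) {} \<phi>" using ex_smaller[of "V - ?S"] a by auto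
  have bx: "b \<notin> N x" "c \<notin> N x" using N_sym[of x b] N_sym[of x c] Na b c dist by auto
  have eq: "N x - ?S = N x - {a, d}" using bx by auto
  have c2: "card (N x - ?S) = 2"
    unfolding eq using dx Na Nd dist finN by (subst card_Diff_subset) auto
  have "x \<in> V - ?S" using Na dist by auto
  from colors_of_remaining_pair[OF \<phi> this c2] obtain p q where
    pq: "N x - ?S = {p, q}" "\<phi> p \<noteq> \<phi> q" "p \<notin> ?S" "q \<notin> ?S" by blast
  have Nx: "N x = {a, d, p, q}" using pq(1) Na Nd bx by auto
  obtain c1 where c1: "c1 \<in> L a" "c1 \<notin> {\<phi> x, \<phi> p, \<phi> q}"
    using ex_notin_if_card_gt[of "[\<phi> x, \<phi> p, \<phi> q]" "L a"] Na by auto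
  obtain c2 where c2: "c2 \<in> L b" "c2 \<notin> {\<phi> x, c1}"
    using ex_notin_if_card_gt[of "[\<phi> x, c1]" "L b"] Nb by auto
  obtain c3 where c3: "c3 \<in> L c" "c3 \<notin> {\<phi> x, c1, c2}"
    using ex_notin_if_card_gt[of "[\<phi> x, c1, c2]" "L c"] Nc by auto
  obtain c4 where c4: "c4 \<in> L d" "c4 \<notin> {\<phi> x, c2, c3}"
    using ex_notin_if_card_gt[of "[\<phi> x, c2, c3]" "L d"] Nd by auto
  let ?\<psi> = "\<phi>(a := c1, b := c2, c := c3, d := c4)"
  have "has_unique_color (N x) ?\<psi>"
  proof (cases "c4 = c1")
    case True
    then show ?thesis
      unfolding Nx using pq(2-4) c1 dist by (intro has_unique_colorI[of p]) auto
  next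
    case False
    then show ?thesis
      unfolding Nx using pq(2-4) c1 dist by (intro has_unique_colorI[of a]) auto
  qed
  moreover have "has_unique_color (N a) ?\<psi>" "has_unique_color (N b) ?\<psi>" "has_unique_color (N c) ?\<psi>"
    "has_unique_color (N d) ?\<psi>"
    unfolding a(2) b(2) c(2) d(2)
    by (rule has_unique_color_pair; use dist c1 c2 c3 c4 in auto)+
  ultimately show False
    using \<phi> a b c d Na Nd dist c1 c2 c3 c4
    by (intro no_extension[of ?S "{x}" \<phi> ?\<psi>]) (auto intro: pcf_except_mono)
qed

text \<open>The outer colors and harmful colors leave two, three, three and two colors. Adjacency
  and the conditions at \<open>b\<close> and \<open>c\<close> require a proper coloring of the
  square of the path.\<close>

lemma no_thread_4:
  assumes a: "a \<in> V" "N a = {x, b}" and b: "b \<in> V" "N b = {a, c}" and c: "c \<in> V" "N c = {b, d}"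
    and d: "d \<in> V" "N d = {c, y}" and dist: "distinct [a, b, c, d, x, y]"
  shows False
proof -
  note Na = N_pairD[OF a] and Nb = N_pairD[OF b] and Nc = N_pairD[OF c] and Nd = N_pairD[OF d]
  let ?S = "{a, b, c, d}"
  obtain \<phi> where \<phi>: "pcf_except E L (V - ?S) {} \<phi>" using ex_smaller[of "V - ?S"] a by auto
  have x: "b \<notin> N x" "c \<notin> N x" "d \<notin> N x" using N_sym[of x b] N_sym[of x c] N_sym[of x d] Na b c d dist by auto
  have y: "a \<notin> N y" "b \<notin> N y" "c \<notin> N y" using N_sym[of y a] N_sym[of y b] N_sym[of y c] Nd a b c dist by auto
  obtain f where f: "\<forall>\<psi>. (\<forall>m\<in>N x - {a}. \<psi> m = \<phi> m) \<longrightarrow> \<psi> a \<noteq> f \<longrightarrow> has_unique_color (N x) \<psi>"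
    using ex_forbidden[OF Na(1,3), of \<phi>] ..
  obtain g where g: "\<forall>\<psi>. (\<forall>m\<in>N y - {d}. \<psi> m = \<phi> m) \<longrightarrow> \<psi> d \<noteq> g \<longrightarrow> has_unique_color (N y) \<psi>"
    using ex_forbidden[OF Nd(2,4), of \<phi>] ..
  have "2 \<le> card (L a - set [\<phi> x, f])" "3 \<le> card (L b - set [\<phi> x])" "3 \<le> card (L c - set [\<phi> y])"
    "2 \<le> card (L d - set [\<phi> y, g])"
    by (rule card_Diff_set_ge; use Na Nb Nc Nd in simp)+
  from ex_path_square_coloring[OF this] obtain c1 c2 c3 c4 where
    cs: "c1 \<in> L a" "c1 \<noteq> \<phi> x" "c1 \<noteq> f" "c2 \<in> L b" "c2 \<noteq> \<phi> x" "c3 \<in> L c" "c3 \<noteq> \<phi> y" "c4 \<in> L d" "c4 \<noteq> \<phi> y" "c4 \<noteq> g"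
      "c1 \<noteq> c2" "c1 \<noteq> c3" "c2 \<noteq> c3" "c2 \<noteq> c4" "c3 \<noteq> c4" by auto
  let ?\<psi> = "\<phi>(a := c1, b := c2, c := c3, d := c4)"
  have fx: "\<forall>m\<in>N x - {a}. ?\<psi> m = \<phi> m" "?\<psi> a \<noteq> f" using x cs dist by auto
  have gy: "\<forall>m\<in>N y - {d}. ?\<psi> m = \<phi> m" "?\<psi> d \<noteq> g" using y cs dist by auto
  have "has_unique_color (N x) ?\<psi>" by (rule f[THEN spec, THEN mp, THEN mp, OF fx])
  moreover have "has_unique_color (N y) ?\<psi>" by (rule g[THEN spec, THEN mp, THEN mp, OF gy])
  moreover have "has_unique_color (N a) ?\<psi>" "has_unique_color (N b) ?\<psi>" "has_unique_color (N c) ?\<psi>"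
    "has_unique_color (N d) ?\<psi>"
    unfolding a(2) b(2) c(2) d(2)
    by (rule has_unique_color_pair; use dist cs in auto)+
  ultimately show False
    using \<phi> a b c d Na Nd dist cs
    by (intro no_extension[of ?S "{x, y}" \<phi> ?\<psi>]) (auto intro: pcf_except_mono)
qed

text \<open>The cases are the possible coincidences of the outer neighbors \<open>x\<close> and
  \<open>y\<close> with the four vertices or with each other.\<close>

lemma no_four_consecutive:
  assumes a: "a \<in> V" "N a = {x, b}" and b: "b \<in> V" "N b = {a, c}" and c: "c \<in> V" "N c = {b, d}"
    and d: "d \<in> V" "N d = {c, y}" and ad: "a \<noteq> d"
  shows False
proof -
  note Ns = N_pairD[OF a] N_pairD[OF b] N_pairD[OF c] N_pairD[OF d]
  have dist: "distinct [a, b, c, d]" using Ns ad by auto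
  have xc: "x \<noteq> c" using N_sym[OF a(1), of x] a c dist by auto
  have yb: "y \<noteq> b" using N_sym[OF d(1), of y] d b dist by auto
  show False
  proof (cases "x = d")
    case True
    then have "y = a" using N_sym[OF a(1), of x] a d dist by auto
    then show ?thesis using no_four_cycle[of a d b c] a b c d True by simp
  next
    case xd: False
    then have ya: "y \<noteq> a" using N_sym[OF d(1), of y] d a dist by auto
    show ?thesis
    proof (cases "x = y")
      case True
      have dist5: "distinct [a, b, c, d, x]" using dist xc xd yb Ns True by auto
      have "2 \<le> card (N x)" "card (N x) \<le> 4" using degree_ge_2 N_le_4 Ns by auto
      then consider "card (N x) = 2" | "card (N x) = 3" | "card (N x) = 4" by linarith
      then show ?thesis
      proof cases
        case 1
        have "N x = {d, a}"
          using card_seteq[OF finN, of "{d, a}" x] 1 Ns True dist by auto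
        then show ?thesis using no_five_cycle[of a x b c d] a b c d Ns True dist5 by auto
      next
        case 2
        then show ?thesis using no_thread_at_degree_3[of a x b c] a b xc by simp
      next
        case 3
        then show ?thesis using no_pendant_five_cycle[of a x b c d] a b c d True dist5 by simp
      qed
    next
      case False
      then have "distinct [a, b, c, d, x, y]" using dist xc xd yb ya Ns by auto
      then show ?thesis using no_thread_4[of a x b c d y] a b c d by simp
    qed
  qed
qed

end

section \<open>Threads\<close>

text \<open>If removing \<open>p\<close> leaves four colors in \<open>B\<close>, any choice of
  \<open>c\<close> costs at most one. Otherwise exactly three are left, and \<open>c\<close> avoids
  these, \<open>p\<close> and \<open>q\<close>: five colors, hence the bound 6.\<close>

lemma ex_color_keeping:
  assumes "6 \<le> card A" "4 \<le> card B"
  shows "\<exists>c\<in>A. c \<noteq> p \<and> c \<noteq> q \<and> 3 \<le> card (B - {c, p})"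
proof (cases "4 \<le> card (B - {p})")
  case True
  obtain c where c: "c \<in> A" "c \<notin> {p, q}" using ex_notin_if_card_gt[of "[p, q]" A] assms(1) by auto
  have "3 \<le> card (B - {p} - set [c])" using card_Diff_set_ge[of 3 "[c]" "B - {p}"] True by simp
  moreover have "B - {p} - set [c] = B - {c, p}" by auto
  ultimately show ?thesis using c by auto
next
  case False
  have fin: "finite B" using assms(2) by (auto intro: card_ge_0_finite)
  obtain ys where ys: "set ys = B - {p}" "distinct ys" using finite_distinct_list[of "B - {p}"] fin by auto
  have "length ys \<le> 3" using False ys distinct_card[of ys] by simp
  then obtain c where c: "c \<in> A" "c \<notin> set (p # q # ys)"
    using ex_notin_if_card_gt[of "p # q # ys" A] assms(1) by auto
  then have "B - {c, p} = B - {p}" using ys(1) by auto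
  moreover have "3 \<le> card (B - {p})" using card_Diff_set_ge[of 3 "[p]" B] assms(2) by simp
  ultimately show ?thesis using c by auto
qed

text \<open>If \<open>t\<close> were in \<open>B\<close>, all of \<open>A\<close> except possibly
  \<open>f\<close> would be, which is at most five colors in total.\<close>

lemma notin_if_remaining_subset:
  assumes "6 \<le> card A" "card B \<le> 4" "finite B" "p \<in> B" "A - {t, f, p} \<subseteq> B"
  shows "t \<notin> B"
proof
  assume t: "t \<in> B"
  have "A \<subseteq> insert f B" using assms(4,5) t by auto
  then have "card A \<le> card (insert f B)" using assms(3) by (intro card_mono) auto
  also have "\<dots> \<le> Suc (card B)" using card_insert_le_m1[of "Suc (card B)" B f] by simp
  finally show False using assms(1,2) by simp
qed

text \<open>By \<open>no_four_consecutive\<close>, three inner vertices suffice. Explicit cases give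
  the exact neighborhoods at once; the list is empty for a single edge, so
  \<open>hd (I @ [y])\<close> is the vertex after \<open>x\<close> in every case.\<close>

inductive thread :: "('a \<Rightarrow> 'a \<Rightarrow> bool) \<Rightarrow> 'a set \<Rightarrow> 'a \<Rightarrow> 'a list \<Rightarrow> 'a \<Rightarrow> bool"
  for E :: "'a \<Rightarrow> 'a \<Rightarrow> bool" and V :: "'a set" where
  thread0: "E x y \<Longrightarrow> thread E V x [] y"
| thread1: "a \<in> V \<Longrightarrow> nb E V a = {x, y} \<Longrightarrow> thread E V x [a] y"
| thread2: "a \<in> V \<Longrightarrow> b \<in> V \<Longrightarrow> nb E V a = {x, b} \<Longrightarrow> nb E V b = {a, y} \<Longrightarrow> thread E V x [a, b] y"
| thread3: "a \<in> V \<Longrightarrow> b \<in> V \<Longrightarrow> c \<in> V \<Longrightarrow> nb E V a = {x, b} \<Longrightarrow> nb E V b = {a, c} \<Longrightarrow>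
    nb E V c = {b, y} \<Longrightarrow> thread E V x [a, b, c] y"

definition branch :: "('a \<Rightarrow> 'a \<Rightarrow> bool) \<Rightarrow> 'a set \<Rightarrow> 'a set" where
  "branch E V = {v \<in> V. 3 \<le> card (nb E V v)}"

context min_counterexample
begin

abbreviation B :: "'a set" where "B \<equiv> branch E V"

lemma branch_in_V: "x \<in> B \<Longrightarrow> x \<in> V" by (simp add: branch_def)

lemma not_branch: "N v = {x, y} \<Longrightarrow> v \<notin> B"
  by (auto simp: branch_def card_insert_if split: if_splits)

text \<open>Otherwise a color \<open>\<eta>\<close> of \<open>b\<close> that is not available at \<open>a\<close> could be deleted from the list of
  \<open>y\<close>, which has a spare color once the thread is deleted, and then be used for \<open>b\<close>.\<close>
lemma three_thread_lists:
  assumes a: "a \<in> V" "N a = {x, b}" and b: "b \<in> V" "N b = {a, c}" and c: "c \<in> V" "N c = {b, y}"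
    and xy: "x \<noteq> y" and dy: "card (N y) = 4"
  shows "L b = L a"
proof (rule ccontr)
  assume neq: "L b \<noteq> L a"
  note Na = N_pairD[OF a] and Nb = N_pairD[OF b] and Nc = N_pairD[OF c]
  have finL: "finite (L a)" "finite (L b)" using Na Nb by (auto intro: card_ge_0_finite)
  have "\<not> (L b \<subseteq> L a \<and> card (L a) \<le> 4)"
    using card_seteq[OF finL(1), of "L b"] Nb(7) neq by auto
  \<comment> \<open>In the second alternative \<open>\<eta>\<close> is arbitrary: then
    \<open>a\<close> has a spare color anyway.\<close>
  then have "\<exists>\<eta>. \<eta> \<in> L b - L a \<or> 5 \<le> card (L a)" by (cases "L b \<subseteq> L a") auto
  then obtain \<eta> where \<eta>: "\<eta> \<in> L b - L a \<or> 5 \<le> card (L a)" ..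
  let ?S = "{a, b, c}"
  have y_neq: "y \<noteq> a" "y \<noteq> b"
    using dy a(2) b(2) by (auto simp: card_insert_if split: if_splits)
  have "x \<noteq> c"
  proof
    assume "x = c"
    then have "a \<in> N c" using Na(3) by simp
    then show False using c(2) Nb(5) y_neq by auto
  qed
  then have x: "b \<notin> N x" "c \<notin> N x"
    using N_sym[OF Na(1), of b] N_sym[OF Na(1), of c] b(2) c(2) Na(5,6,8) xy by auto
  have y: "a \<notin> N y" "b \<notin> N y"
    using N_sym[OF Nc(2), of a] N_sym[OF Nc(2), of b] a(2) b(2) Nc(6,8) xy y_neq by auto
  have yS: "y \<in> V - ?S" "x \<in> V - ?S" using Na Nc y_neq \<open>x \<noteq> c\<close> by auto
  \<comment> \<open>\<open>y\<close> has at least six colors and keeps three neighbors, so five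
    colors are enough for the smaller graph.\<close>
  let ?L = "L(y := L y - {\<eta>})"
  have "nb E (V - ?S) y = N y - {c}" using y by (auto simp: nb_Diff)
  then have "card (nb E (V - ?S) y) = 3" using dy Nc finN by simp
  moreover have "5 \<le> card (L y - {\<eta>})"
    using card_Diff_set_ge[of 5 "[\<eta>]" "L y"] card_L[of y] dy Nc by simp
  ultimately have "list_ok E ?L (V - ?S)"
    by (intro list_ok_subset[OF ok]) auto
  then obtain \<phi> where "pcf_except E ?L (V - ?S) {} \<phi>"
    using smaller[of "V - ?S" ?L] a by auto
  then have \<phi>: "pcf_except E L (V - ?S) {} \<phi>" and y\<eta>: "\<phi> y \<noteq> \<eta>"
    using yS by (auto simp: pcf_except_def split: if_splits)
  obtain f where f: "\<forall>\<psi>. (\<forall>m\<in>N x - {a}. \<psi> m = \<phi> m) \<longrightarrow> \<psi> a \<noteq> f \<longrightarrow> has_unique_color (N x) \<psi>"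
    using ex_forbidden[OF Na(1,3), of \<phi>] ..
  obtain g where g: "\<forall>\<psi>. (\<forall>m\<in>N y - {c}. \<psi> m = \<phi> m) \<longrightarrow> \<psi> c \<noteq> g \<longrightarrow> has_unique_color (N y) \<psi>"
    using ex_forbidden[OF Nc(2,4), of \<phi>] ..
  have "\<exists>c1\<in>L a. \<exists>c2\<in>L b. \<exists>c3\<in>L c. c1 \<notin> {\<phi> x, f, c2, c3} \<and> c2 \<notin> {\<phi> x, \<phi> y, c3} \<and> c3 \<notin> {\<phi> y, g}"
  proof (cases "3 \<le> card (L a - {\<phi> x, f})")
    case True
    obtain c2 where c2: "c2 \<in> L b" "c2 \<notin> {\<phi> x, \<phi> y}"
      using ex_notin_if_card_gt[of "[\<phi> x, \<phi> y]" "L b"] Nb(7) by auto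
    obtain c3 where c3: "c3 \<in> L c" "c3 \<notin> {\<phi> y, g, c2}"
      using ex_notin_if_card_gt[of "[\<phi> y, g, c2]" "L c"] Nc(7) by auto
    obtain c1 where c1: "c1 \<in> L a - {\<phi> x, f}" "c1 \<notin> {c2, c3}"
      using ex_notin_if_card_gt[of "[c2, c3]" "L a - {\<phi> x, f}"] True by auto
    show ?thesis using c1 c2 c3 by (intro bexI[of _ c1] bexI[of _ c2] bexI[of _ c3]) auto
  next
    case False
    \<comment> \<open>Here \<open>L a\<close> has four colors, among them \<open>\<phi> x\<close>
      and \<open>f\<close>. So \<open>\<eta>\<close> lies outside \<open>L a\<close>, and giving it
      to \<open>b\<close> costs \<open>a\<close> nothing.\<close>
    have "\<not> 5 \<le> card (L a)" using card_Diff_set_ge[of 3 "[\<phi> x, f]" "L a"] False by auto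
    with \<eta> have \<eta>': "\<eta> \<in> L b" "\<eta> \<notin> L a" by auto
    have "\<eta> \<noteq> \<phi> x"
    proof
      assume "\<eta> = \<phi> x"
      then have "L a - {\<phi> x, f} = L a - {f}" using \<eta>' by auto
      then show False using card_Diff_set_ge[of 3 "[f]" "L a"] Na(7) False by simp
    qed
    obtain c3 where c3: "c3 \<in> L c" "c3 \<notin> {\<phi> y, g, \<eta>}"
      using ex_notin_if_card_gt[of "[\<phi> y, g, \<eta>]" "L c"] Nc(7) by auto
    obtain c1 where c1: "c1 \<in> L a" "c1 \<notin> {\<phi> x, f, c3}"
      using ex_notin_if_card_gt[of "[\<phi> x, f, c3]" "L a"] Na(7) by auto
    show ?thesis
      using c1 c3 \<eta>' y\<eta> \<open>\<eta> \<noteq> \<phi> x\<close> by (intro bexI[of _ c1] bexI[of _ \<eta>] bexI[of _ c3]) auto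
  qed
  then obtain c1 c2 c3 where
    cs: "c1 \<in> L a" "c2 \<in> L b" "c3 \<in> L c" "c1 \<notin> {\<phi> x, f, c2, c3}" "c2 \<notin> {\<phi> x, \<phi> y, c3}" "c3 \<notin> {\<phi> y, g}"
    by (elim bexE conjE)
  let ?\<psi> = "\<phi>(a := c1, b := c2, c := c3)"
  have dist: "a \<noteq> b" "b \<noteq> c" "a \<noteq> c" using Nb by auto
  have fx: "\<forall>m\<in>N x - {a}. ?\<psi> m = \<phi> m" "?\<psi> a \<noteq> f" using x cs dist by auto
  have gy: "\<forall>m\<in>N y - {c}. ?\<psi> m = \<phi> m" "?\<psi> c \<noteq> g" using y cs dist by auto
  have "has_unique_color (N x) ?\<psi>" by (rule f[THEN spec, THEN mp, THEN mp, OF fx])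
  moreover have "has_unique_color (N y) ?\<psi>" by (rule g[THEN spec, THEN mp, THEN mp, OF gy])
  moreover have "has_unique_color (N a) ?\<psi>" "has_unique_color (N b) ?\<psi>" "has_unique_color (N c) ?\<psi>"
    unfolding a(2) b(2) c(2)
    by (rule has_unique_color_pair; use dist yS cs in auto)+
  ultimately show False
    using \<phi> a b c yS dist cs
    by (intro no_extension[of ?S "{x, y}" \<phi> ?\<psi>]) (auto intro: pcf_except_mono)
qed

lemma thread_interior:
  assumes "thread E V x I y" "s \<in> set I"
  shows "s \<in> V" "s \<notin> B" "N s \<subseteq> set I \<union> {x, y}" "4 \<le> card (L s)"
  using assms by (cases; auto dest: not_branch N_pairD(7))+

lemma thread_ends:
  assumes "thread E V x I y" "x \<in> B" "y \<in> B" "x \<noteq> y" "s \<in> set I"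
  shows "x \<in> N s \<longleftrightarrow> s = hd I" "y \<in> N s \<longleftrightarrow> s = last I"
proof -
  note nB = thread_interior(2)[OF assms(1)]
  from assms(1) show "x \<in> N s \<longleftrightarrow> s = hd I" "y \<in> N s \<longleftrightarrow> s = last I"
    by (cases; use assms nB in \<open>auto simp: doubleton_eq_iff\<close>)+
qed

lemma thread_rev: "thread E V x I y \<Longrightarrow> thread E V y (rev I) x"
  by (induction rule: thread.cases) (auto intro!: thread.intros sym simp: insert_commute)

text \<open>A common inner vertex determines both threads up to direction. Opposite directions would
  lead the second thread back to \<open>x\<close>, and equal directions give the same first
  vertex.\<close>

lemma thread_disjoint:
  assumes "thread E V x I y" "thread E V x J z" "x \<in> B" "y \<in> B" "z \<in> B" "x \<noteq> y" "x \<noteq> z"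
    and "hd (I @ [y]) \<noteq> hd (J @ [z])"
  shows "set I \<inter> set J = {}"
proof -
  note nI = thread_interior(2)[OF assms(1)] and nJ = thread_interior(2)[OF assms(2)]
  from assms(1) show ?thesis
  proof cases
    case thread0
    then show ?thesis by simp
  next
    case (thread1 a)
    from assms(2) show ?thesis by cases (use assms(3-) nI nJ thread1 in \<open>auto simp: doubleton_eq_iff\<close>)
  next
    case (thread2 a b)
    from assms(2) show ?thesis by cases (use assms(3-) nI nJ thread2 in \<open>auto simp: doubleton_eq_iff\<close>)
  next
    case (thread3 a b c)
    from assms(2) show ?thesis by cases (use assms(3-) nI nJ thread3 in \<open>auto simp: doubleton_eq_iff\<close>)
  qed
qed

text \<open>Seen from \<open>y\<close>, the last two inner vertices would form the configuration of
  \<open>no_thread_at_degree_3\<close>.\<close>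

lemma long_thread_degree:
  assumes "thread E V x I y" "y \<in> B" "x \<noteq> y" "2 \<le> length I"
  shows "card (N y) = 4"
proof -
  have "card (N y) \<noteq> 3"
    using assms(1)
  proof cases
    case (thread2 a b)
    then show ?thesis using no_thread_at_degree_3[of b y a x] assms(3) by (auto simp: insert_commute)
  next
    case (thread3 a b c)
    then have "a \<notin> B" using not_branch by blast
    then show ?thesis using thread3 no_thread_at_degree_3[of c y b a] assms(2) by (auto simp: insert_commute)
  qed (use assms(4) in auto)
  then show ?thesis using assms(2) N_le_4[of y] by (auto simp: branch_def)
qed

text \<open>\<open>g\<close> and \<open>h\<close> will be the harmful colors for \<open>y\<close>
  and \<open>x\<close>. With at most two inner vertices the first one is colored last; three colors
  beyond those of the ends then withstand the two remaining restrictions.\<close>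

lemma extend_thread:
  assumes thr: "thread E V x I y" and xy: "x \<in> B" "y \<in> B" "x \<noteq> y" and I: "I \<noteq> []"
    and \<phi>: "pcf_except E L W D \<phi>" and W: "W \<subseteq> V" "x \<in> W" "y \<in> W" "{x, y} \<subseteq> D" "set I \<inter> W = {}"
    and neq: "\<phi> x \<noteq> \<phi> y"
  shows "\<exists>\<psi>. (\<forall>w\<in>W. \<psi> w = \<phi> w) \<and> pcf_except E L (W \<union> set I) D \<psi> \<and> \<psi> (last I) \<noteq> g \<and>
    (3 \<le> card (L (hd I) - {\<phi> x, \<phi> y}) \<longrightarrow> \<psi> (hd I) \<noteq> h)"
proof -
  note int = thread_interior[OF thr]
  have nbI: "nb E (W \<union> set I) s = N s" if "s \<in> set I" for s
  proof
    show "nb E (W \<union> set I) s \<subseteq> N s" using W(1) int(1) by (auto simp: nb_def)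
    show "N s \<subseteq> nb E (W \<union> set I) s" using int(3)[OF that] W(2,3) by (auto simp: nb_def)
  qed
  have nbW: "nb E W s \<subseteq> D" if "s \<in> set I" for s
  proof -
    have "nb E W s \<subseteq> N s \<inter> W" using W(1) by (auto simp: nb_def)
    then show ?thesis using int(3)[OF that] W(4,5) by blast
  qed
  have ext: "pcf_except E L (W \<union> set I) D \<psi>"
    if "\<And>w. w \<in> W \<Longrightarrow> \<psi> w = \<phi> w" "\<And>s. s \<in> set I \<Longrightarrow> \<psi> s \<in> L s"
      "\<And>s u. s \<in> set I \<Longrightarrow> u \<in> N s \<Longrightarrow> \<psi> u \<noteq> \<psi> s" "\<And>s. s \<in> set I \<Longrightarrow> has_unique_color (N s) \<psi>" for \<psi>
    using that nbI nbW
    by (intro pcf_except_extend[OF \<phi> sgraph_axioms W(5)]) auto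
  from thr show ?thesis
  proof cases
    case thread0
    then show ?thesis using I by simp
  next
    case (thread1 a)
    let ?A = "L a - {\<phi> x, \<phi> y}"
    have La: "4 \<le> card (L a)" using int(4) thread1 by simp
    have a: "a \<notin> W" using W(5) thread1 by simp
    have "\<exists>c\<in>?A. c \<noteq> g \<and> (3 \<le> card ?A \<longrightarrow> c \<noteq> h)"
    proof (cases "3 \<le> card ?A")
      case True
      then show ?thesis using ex_notin_if_card_gt[of "[g, h]" ?A] by auto
    next
      case False
      then show ?thesis using ex_notin_if_card_gt[of "[\<phi> x, \<phi> y, g]" "L a"] La by auto
    qed
    then obtain c where c: "c \<in> ?A" "c \<noteq> g" "3 \<le> card ?A \<longrightarrow> c \<noteq> h" by blast
    have "pcf_except E L (W \<union> set I) D (\<phi>(a := c))"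
      using thread1 a c W(2,3) neq by (intro ext) (auto simp: has_unique_color_pair)
    then show ?thesis
      using thread1 a c by (intro exI[of _ "\<phi>(a := c)"]) auto
  next
    case (thread2 a b)
    have La: "4 \<le> card (L a)" "4 \<le> card (L b)" using int(4) thread2 by simp_all
    have ab: "a \<notin> W" "b \<notin> W" "a \<noteq> b" using W(5) thread2 N_pairD(6)[of a x b] by auto
    let ?A = "L a - {\<phi> x, \<phi> y}"
    obtain c2 where c2: "c2 \<in> L b" "c2 \<notin> {\<phi> x, \<phi> y, g}"
      using ex_notin_if_card_gt[of "[\<phi> x, \<phi> y, g]" "L b"] La by auto
    have "\<exists>c\<in>?A. c \<noteq> c2 \<and> (3 \<le> card ?A \<longrightarrow> c \<noteq> h)"
    proof (cases "3 \<le> card ?A")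
      case True
      then show ?thesis using ex_notin_if_card_gt[of "[c2, h]" ?A] by auto
    next
      case False
      then show ?thesis using ex_notin_if_card_gt[of "[\<phi> x, \<phi> y, c2]" "L a"] La by auto
    qed
    then obtain c where c: "c \<in> ?A" "c \<noteq> c2" "3 \<le> card ?A \<longrightarrow> c \<noteq> h" by blast
    let ?\<psi> = "\<phi>(a := c, b := c2)"
    have agree: "?\<psi> w = \<phi> w" if "w \<in> W" for w using ab that by auto
    have vals: "?\<psi> a = c" "?\<psi> b = c2" "?\<psi> x = \<phi> x" "?\<psi> y = \<phi> y" using ab(3) agree W(2,3) by auto
    have "pcf_except E L (W \<union> set I) D ?\<psi>"
    proof (rule ext)
      fix s assume "s \<in> set I"
      then have s: "s = a \<or> s = b" using thread2(1) by simp
      show "?\<psi> s \<in> L s" using s c(1) c2(1) ab(3) by auto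
      show "?\<psi> u \<noteq> ?\<psi> s" if u: "u \<in> N s" for u
      proof -
        have "(s = a \<and> (u = x \<or> u = b)) \<or> (s = b \<and> (u = a \<or> u = y))" using s u thread2(4,5) by auto
        then show ?thesis using vals c c2 by (elim disjE conjE) (simp_all only:, auto)
      qed
      show "has_unique_color (N s) ?\<psi>"
        using s
      proof
        assume "s = a"
        then show ?thesis unfolding \<open>s = a\<close> thread2(4)
          by (intro has_unique_color_pair) (use vals c2 in \<open>simp only:, auto\<close>)
      next
        assume "s = b"
        then show ?thesis unfolding \<open>s = b\<close> thread2(5)
          by (intro has_unique_color_pair) (use vals c in \<open>simp only:, auto\<close>)
      qed
    qed (rule agree)
    moreover have "?\<psi> (last I) \<noteq> g" using thread2(1) c2 by simp
    moreover have "3 \<le> card (L (hd I) - {\<phi> x, \<phi> y}) \<longrightarrow> ?\<psi> (hd I) \<noteq> h"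
      using thread2(1) c(3) ab(3) by simp
    ultimately show ?thesis using agree by (intro exI[of _ ?\<psi>]) simp
  next
    case (thread3 a b c)
    have L4: "4 \<le> card (L a)" "4 \<le> card (L b)" "4 \<le> card (L c)" using int(4) thread3 by simp_all
    have abc: "a \<notin> W" "b \<notin> W" "c \<notin> W" "a \<noteq> b" "b \<noteq> c" "a \<noteq> c"
      using W(5) thread3 N_pairD(6)[of a x b] N_pairD(6)[of b a c] N_pairD(8)[of b a c] by auto
    have "card (N y) = 4" using long_thread_degree[OF thr] xy thread3 by simp
    \<comment> \<open>The assumption counts colors of \<open>L a\<close> only. Equal lists transfer
      it to \<open>b\<close>, which must differ from both ends because of the conditions at
      \<open>a\<close> and \<open>c\<close>.\<close>
    then have eq: "L b = L a" using three_thread_lists[of a x b c y] thread3 xy(3) by blast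
    let ?A = "L a - {\<phi> x, \<phi> y}"
    have "\<exists>c1\<in>L a. \<exists>c2\<in>?A. \<exists>c3\<in>L c. c1 \<notin> {\<phi> x, c2, c3} \<and> c2 \<noteq> c3 \<and> c3 \<notin> {\<phi> y, g} \<and> (3 \<le> card ?A \<longrightarrow> c1 \<noteq> h)"
    proof (cases "3 \<le> card ?A")
      case True
      \<comment> \<open>Now the middle vertex comes last: three colors against those of
        \<open>a\<close> and \<open>c\<close>.\<close>
      obtain c1 where c1: "c1 \<in> L a" "c1 \<notin> {\<phi> x, h}"
        using ex_notin_if_card_gt[of "[\<phi> x, h]" "L a"] L4 by auto
      obtain c3 where c3: "c3 \<in> L c" "c3 \<notin> {\<phi> y, g, c1}"
        using ex_notin_if_card_gt[of "[\<phi> y, g, c1]" "L c"] L4 by auto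
      obtain c2 where c2: "c2 \<in> ?A" "c2 \<notin> {c1, c3}"
        using ex_notin_if_card_gt[of "[c1, c3]" ?A] True by auto
      show ?thesis using c1 c2 c3 by (intro bexI[of _ c1] bexI[of _ c2] bexI[of _ c3]) auto
    next
      case False
      obtain c3 where c3: "c3 \<in> L c" "c3 \<notin> {\<phi> y, g}"
        using ex_notin_if_card_gt[of "[\<phi> y, g]" "L c"] L4 by auto
      obtain c2 where c2: "c2 \<in> L a" "c2 \<notin> {\<phi> x, \<phi> y, c3}"
        using ex_notin_if_card_gt[of "[\<phi> x, \<phi> y, c3]" "L a"] L4 by auto
      obtain c1 where c1: "c1 \<in> L a" "c1 \<notin> {\<phi> x, c2, c3}"
        using ex_notin_if_card_gt[of "[\<phi> x, c2, c3]" "L a"] L4 by auto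
      show ?thesis using c1 c2 c3 False by (intro bexI[of _ c1] bexI[of _ c2] bexI[of _ c3]) auto
    qed
    then obtain c1 c2 c3 where cs: "c1 \<in> L a" "c2 \<in> ?A" "c3 \<in> L c" "c1 \<notin> {\<phi> x, c2, c3}" "c2 \<noteq> c3"
      "c3 \<notin> {\<phi> y, g}" "3 \<le> card ?A \<longrightarrow> c1 \<noteq> h" by (elim bexE conjE)
    let ?\<psi> = "\<phi>(a := c1, b := c2, c := c3)"
    have agree: "?\<psi> w = \<phi> w" if "w \<in> W" for w using abc that by auto
    have vals: "?\<psi> a = c1" "?\<psi> b = c2" "?\<psi> c = c3" "?\<psi> x = \<phi> x" "?\<psi> y = \<phi> y"
      using abc(4-6) agree W(2,3) by auto
    have "pcf_except E L (W \<union> set I) D ?\<psi>"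
    proof (rule ext)
      fix s assume "s \<in> set I"
      then have s: "s = a \<or> s = b \<or> s = c" using thread3(1) by simp
      then show "?\<psi> s \<in> L s" using vals cs(1-3) eq by (elim disjE) (simp_all only:, auto)
      show "?\<psi> u \<noteq> ?\<psi> s" if u: "u \<in> N s" for u
      proof -
        have "(s = a \<and> (u = x \<or> u = b)) \<or> (s = b \<and> (u = a \<or> u = c)) \<or> (s = c \<and> (u = b \<or> u = y))"
          using s u thread3(5-7) by auto
        then show ?thesis using vals cs by (elim disjE conjE) (simp_all only:, auto)
      qed
      show "has_unique_color (N s) ?\<psi>"
        using s
      proof (elim disjE)
        assume "s = a"
        then show ?thesis unfolding \<open>s = a\<close> thread3(5)
          by (intro has_unique_color_pair) (use vals cs in \<open>simp only:, auto\<close>)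
      next
        assume "s = b"
        then show ?thesis unfolding \<open>s = b\<close> thread3(6)
          by (intro has_unique_color_pair) (use vals cs in \<open>simp only:, auto\<close>)
      next
        assume "s = c"
        then show ?thesis unfolding \<open>s = c\<close> thread3(7)
          by (intro has_unique_color_pair) (use vals cs in \<open>simp only:, auto\<close>)
      qed
    qed (rule agree)
    moreover have "?\<psi> (last I) \<noteq> g" using thread3(1) cs(6) by simp
    moreover have "3 \<le> card (L (hd I) - {\<phi> x, \<phi> y}) \<longrightarrow> ?\<psi> (hd I) \<noteq> h"
      using thread3(1) cs(7) abc(4-6) by simp
    ultimately show ?thesis using agree by (intro exI[of _ ?\<psi>]) simp
  qed
qed

lemma extend_thread':
  assumes thr: "thread E V x I y" and xy: "x \<in> B" "y \<in> B" "x \<noteq> y"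
    and \<phi>: "pcf_except E L W D \<phi>" and W: "W \<subseteq> V" "x \<in> W" "y \<in> W" "{x, y} \<subseteq> D" "set I \<inter> W = {}"
    and neq: "\<phi> x \<noteq> \<phi> y"
  shows "\<exists>\<psi>. (\<forall>w\<in>W. \<psi> w = \<phi> w) \<and> pcf_except E L (W \<union> set I) D \<psi>"
proof (cases "I = []")
  case True
  then show ?thesis using \<phi> by auto
next
  case False
  show ?thesis using extend_thread[OF thr xy False \<phi> W neq, of undefined undefined] by blast
qed

text \<open>For the last uncolored thread at \<open>y\<close>: all other neighbors of
  \<open>y\<close> are colored, so its harmful color is known. The same holds at \<open>x\<close> if
  its neighborhood is complete. An edge gives no such freedom, hence
  \<open>I \<noteq> []\<close>.\<close>

lemma finish_thread:
  assumes thr: "thread E V x I y" and xy: "x \<in> B" "y \<in> B" "x \<noteq> y" and I: "I \<noteq> []"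
    and \<phi>: "pcf_except E L W D \<phi>" and W: "W \<subseteq> V" "x \<in> W" "y \<in> W" "{x, y} \<subseteq> D" "set I \<inter> W = {}"
    and neq: "\<phi> x \<noteq> \<phi> y" and Ny: "N y \<subseteq> W \<union> set I"
  shows "\<exists>\<psi>. (\<forall>w\<in>W. \<psi> w = \<phi> w) \<and> pcf_except E L (W \<union> set I) (D - {y}) \<psi> \<and>
    (3 \<le> card (L (hd I) - {\<phi> x, \<phi> y}) \<longrightarrow> N x \<subseteq> W \<union> set I \<longrightarrow> has_unique_color (N x) \<psi>)"
proof -
  have V: "x \<in> V" "y \<in> V" "hd I \<in> set I" "last I \<in> set I" using xy I branch_in_V by auto
  note ends = thread_ends[OF thr xy]
  have hx: "hd I \<in> N x" using ends(1)[OF V(3)] N_sym[of "hd I" x] thread_interior(1)[OF thr V(3)] by simp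
  have ly: "last I \<in> N y" using ends(2)[OF V(4)] N_sym[of "last I" y] thread_interior(1)[OF thr V(4)] by simp
  obtain g where g: "\<forall>\<psi>. (\<forall>m\<in>N y - {last I}. \<psi> m = \<phi> m) \<longrightarrow> \<psi> (last I) \<noteq> g \<longrightarrow> has_unique_color (N y) \<psi>"
    using ex_forbidden[OF V(2) ly, of \<phi>] ..
  obtain h where h: "\<forall>\<psi>. (\<forall>m\<in>N x - {hd I}. \<psi> m = \<phi> m) \<longrightarrow> \<psi> (hd I) \<noteq> h \<longrightarrow> has_unique_color (N x) \<psi>"
    using ex_forbidden[OF V(1) hx, of \<phi>] ..
  obtain \<psi> where \<psi>: "\<forall>w\<in>W. \<psi> w = \<phi> w" "pcf_except E L (W \<union> set I) D \<psi>" "\<psi> (last I) \<noteq> g"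
    "3 \<le> card (L (hd I) - {\<phi> x, \<phi> y}) \<longrightarrow> \<psi> (hd I) \<noteq> h"
    using extend_thread[OF thr xy I \<phi> W neq, of g h] by (elim exE conjE)
  have y_sub: "N y - {last I} \<subseteq> W" using Ny ends(2) N_sym[OF V(2)] by blast
  then have "\<forall>m\<in>N y - {last I}. \<psi> m = \<phi> m" using \<psi>(1) by blast
  from g[THEN spec, THEN mp, THEN mp, OF this \<psi>(3)] have uy: "has_unique_color (N y) \<psi>" .
  have "nb E (W \<union> set I) y = N y" using Ny W(1) thread_interior(1)[OF thr] by (auto simp: nb_def)
  then have 1: "pcf_except E L (W \<union> set I) (D - {y}) \<psi>"
    using uy by (intro pcf_except_finish[OF \<psi>(2)]) auto
  have 2: "has_unique_color (N x) \<psi>" if k: "3 \<le> card (L (hd I) - {\<phi> x, \<phi> y})" and "N x \<subseteq> W \<union> set I"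
  proof -
    have "N x - {hd I} \<subseteq> W" using that(2) ends(1) N_sym[OF V(1)] by blast
    then have "\<forall>m\<in>N x - {hd I}. \<psi> m = \<phi> m" using \<psi>(1) by blast
    then show ?thesis using h[THEN spec, THEN mp, THEN mp] \<psi>(4) k by simp
  qed
  show ?thesis using \<psi>(1) 1 2 by (intro exI[of _ \<psi>]) simp
qed

lemma recolor_center:
  assumes \<phi>: "pcf_except E L (V - S) {} \<phi>" and x: "x \<in> S" "S \<subseteq> V"
    and c: "c \<in> L x" "\<And>u. u \<in> N x - S \<Longrightarrow> \<phi> u \<noteq> c"
  shows "pcf_except E L (V - S \<union> {x}) ({x} \<union> (N x - S)) (\<phi>(x := c))"
proof (rule pcf_except_extend[where \<phi> = \<phi>, OF _ sgraph_axioms])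
  show "pcf_except E L (V - S) ({x} \<union> (N x - S)) \<phi>" using \<phi> by (rule pcf_except_mono) simp
  fix s u assume "s \<in> {x}" "u \<in> nb E (V - S \<union> {x}) s"
  then have "u \<in> N x - S" using irr x by (auto simp: nb_def)
  then show "(\<phi>(x := c)) u \<noteq> (\<phi>(x := c)) s" using c(2)[of u] \<open>s \<in> {x}\<close> x by auto
next
  fix s assume "s \<in> {x}" then show "nb E (V - S) s \<subseteq> {x} \<union> (N x - S)" by (auto simp: nb_Diff)
qed (use x c in auto)

section \<open>Branch vertices of degree 4\<close>

lemma first_in_thread: "hd (I @ [y]) \<in> set I \<union> {y}"
  by (cases I) auto

lemma thread_avoids:
  assumes "thread E V x I y" "z \<in> B" "z \<noteq> x" "z \<noteq> y"
  shows "N z \<inter> set I = {}"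
proof -
  have "False" if m: "m \<in> N z" "m \<in> set I" for m
  proof -
    have "z \<in> N m" using N_sym[OF branch_in_V[OF assms(2)] m(1)] .
    then show False using thread_interior(2,3)[OF assms(1)] m(2) assms(2-) by blast
  qed
  then show ?thesis by blast
qed

text \<open>The color of \<open>x\<close> leaves three colors at the first vertex of
  \<open>I1\<close>. The threads are colored in the order \<open>I4\<close>, \<open>I3\<close>,
  \<open>I2\<close>, \<open>I1\<close>: \<open>I3\<close> settles \<open>z\<close>, and
  \<open>I1\<close> settles \<open>y\<close> and \<open>x\<close>.\<close>

lemma no_two_pairs:
  assumes xyz: "x \<in> B" "y \<in> B" "z \<in> B" "x \<noteq> y" "x \<noteq> z" "y \<noteq> z" and dx: "card (N x) = 4"
    and t1: "thread E V x I1 y" and t2: "thread E V x I2 y"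
    and t3: "thread E V x I3 z" and t4: "thread E V x I4 z"
    and Nx: "N x = {hd (I1 @ [y]), hd (I2 @ [y]), hd (I3 @ [z]), hd (I4 @ [z])}"
    and dist: "distinct [hd (I1 @ [y]), hd (I2 @ [y]), hd (I3 @ [z]), hd (I4 @ [z])]"
    and I: "I1 \<noteq> []" "I3 \<noteq> []"
  shows False
proof -
  note V = branch_in_V[OF xyz(1)] branch_in_V[OF xyz(2)] branch_in_V[OF xyz(3)]
  define S where "S = {x} \<union> set I1 \<union> set I2 \<union> set I3 \<union> set I4"
  note int = thread_interior[OF t1] thread_interior[OF t2] thread_interior[OF t3] thread_interior[OF t4]
  have SV: "S \<subseteq> V" using V int(1,5,9,13) by (auto simp: S_def)
  have xS: "x \<in> S" by (simp add: S_def)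
  have yz: "y \<notin> S" "z \<notin> S" using xyz int(2,6,10,14) by (auto simp: S_def)
  have x_int: "x \<notin> set I1" "x \<notin> set I2" "x \<notin> set I3" "x \<notin> set I4" using xyz int(2,6,10,14) by auto
  have disj: "set I1 \<inter> set I2 = {}" "set I1 \<inter> set I3 = {}" "set I1 \<inter> set I4 = {}"
    "set I2 \<inter> set I3 = {}" "set I2 \<inter> set I4 = {}" "set I3 \<inter> set I4 = {}"
    using thread_disjoint[OF t1 t2] thread_disjoint[OF t1 t3] thread_disjoint[OF t1 t4]
      thread_disjoint[OF t2 t3] thread_disjoint[OF t2 t4] thread_disjoint[OF t3 t4] xyz dist by auto
  have "V - S \<subset> V" using xS SV by blast
  from ex_smaller[OF this] obtain \<phi> where \<phi>: "pcf_except E L (V - S) {} \<phi>" ..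
  have "hd I1 \<in> set I1" using I by simp
  then have "4 \<le> card (L (hd I1))" using int(4) by blast
  moreover have "6 \<le> card (L x)" using card_L[OF V(1)] dx by simp
  ultimately obtain \<alpha> where \<alpha>: "\<alpha> \<in> L x" "\<alpha> \<noteq> \<phi> y" "\<alpha> \<noteq> \<phi> z" "3 \<le> card (L (hd I1) - {\<alpha>, \<phi> y})"
    using ex_color_keeping[of "L x" "L (hd I1)" "\<phi> y" "\<phi> z"] by blast
  have NxS: "N x - S \<subseteq> {y, z}"
    unfolding Nx S_def using first_in_thread[of I1 y] first_in_thread[of I2 y] first_in_thread[of I3 z]
      first_in_thread[of I4 z] by blast
  define W where "W = V - S \<union> {x}"
  define \<phi>1 where "\<phi>1 = \<phi>(x := \<alpha>)"
  have "pcf_except E L W ({x} \<union> (N x - S)) \<phi>1"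
    unfolding W_def \<phi>1_def using NxS \<alpha> by (intro recolor_center \<phi> xS SV) auto
  then have 1: "pcf_except E L W {x, y, z} \<phi>1" by (rule pcf_except_mono) (use NxS in auto)
  have c1: "\<phi>1 x = \<alpha>" "\<phi>1 y = \<phi> y" "\<phi>1 z = \<phi> z" using xyz by (auto simp: \<phi>1_def)
  have WV: "W \<subseteq> V" using V by (auto simp: W_def)
  have W: "x \<in> W" "y \<in> W" "z \<in> W" using V yz by (auto simp: W_def)
  have WI: "set I1 \<inter> W = {}" "set I2 \<inter> W = {}" "set I3 \<inter> W = {}" "set I4 \<inter> W = {}"
    using x_int by (auto simp: W_def S_def)
  have VW: "V = W \<union> set I4 \<union> set I3 \<union> set I2 \<union> set I1" using SV by (auto simp: W_def S_def)
  have "\<exists>\<psi>. (\<forall>w\<in>W. \<psi> w = \<phi>1 w) \<and> pcf_except E L (W \<union> set I4) {x, y, z} \<psi>"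
    by (rule extend_thread'[OF t4 _ _ _ 1]) (use xyz W WV WI c1 \<alpha> in auto)
  then obtain \<phi>2 where \<phi>2: "\<forall>w\<in>W. \<phi>2 w = \<phi>1 w" and 2: "pcf_except E L (W \<union> set I4) {x, y, z} \<phi>2" by blast
  have Nz: "N z \<subseteq> W \<union> set I4 \<union> set I3"
    using thread_avoids[OF t1 xyz(3)] thread_avoids[OF t2 xyz(3)] xyz VW nb_subset[of E V z] by blast
  have "\<exists>\<psi>. (\<forall>w\<in>W \<union> set I4. \<psi> w = \<phi>2 w) \<and> pcf_except E L (W \<union> set I4 \<union> set I3) ({x, y, z} - {z}) \<psi> \<and>
    (3 \<le> card (L (hd I3) - {\<phi>2 x, \<phi>2 z}) \<longrightarrow> N x \<subseteq> W \<union> set I4 \<union> set I3 \<longrightarrow> has_unique_color (N x) \<psi>)"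
    by (rule finish_thread[OF t3 _ _ _ I(2) 2]) (use xyz W WV WI VW disj c1 \<alpha> \<phi>2 Nz in auto)
  then obtain \<phi>3 where \<phi>3: "\<forall>w\<in>W \<union> set I4. \<phi>3 w = \<phi>2 w"
    and "pcf_except E L (W \<union> set I4 \<union> set I3) ({x, y, z} - {z}) \<phi>3" by blast
  then have 3: "pcf_except E L (W \<union> set I4 \<union> set I3) {x, y} \<phi>3" by (elim pcf_except_mono) auto
  have c3: "\<phi>3 x = \<alpha>" "\<phi>3 y = \<phi> y" using \<phi>3 \<phi>2 c1 W by auto
  have "\<exists>\<psi>. (\<forall>w\<in>W \<union> set I4 \<union> set I3. \<psi> w = \<phi>3 w) \<and> pcf_except E L (W \<union> set I4 \<union> set I3 \<union> set I2) {x, y} \<psi>"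
    by (rule extend_thread'[OF t2 _ _ _ 3]) (use xyz W WV WI VW disj c3 \<alpha> in auto)
  then obtain \<phi>4 where \<phi>4: "\<forall>w\<in>W \<union> set I4 \<union> set I3. \<phi>4 w = \<phi>3 w"
    and 4: "pcf_except E L (W \<union> set I4 \<union> set I3 \<union> set I2) {x, y} \<phi>4" by blast
  have c4: "\<phi>4 x = \<alpha>" "\<phi>4 y = \<phi> y" using \<phi>4 c3 W by auto
  have "\<exists>\<psi>. (\<forall>w\<in>W \<union> set I4 \<union> set I3 \<union> set I2. \<psi> w = \<phi>4 w) \<and>
    pcf_except E L (W \<union> set I4 \<union> set I3 \<union> set I2 \<union> set I1) ({x, y} - {y}) \<psi> \<and>
    (3 \<le> card (L (hd I1) - {\<phi>4 x, \<phi>4 y}) \<longrightarrow> N x \<subseteq> W \<union> set I4 \<union> set I3 \<union> set I2 \<union> set I1 \<longrightarrow> has_unique_color (N x) \<psi>)"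
    by (rule finish_thread[OF t1 _ _ _ I(1) 4])
      (use xyz W WV WI VW disj c4 \<alpha> nb_subset[of E V y] in auto)
  then obtain \<psi> where \<psi>: "pcf_except E L V ({x, y} - {y}) \<psi>" "has_unique_color (N x) \<psi>"
    using VW[symmetric] c4 \<alpha>(4) nb_subset[of E V x] by auto
  have "pcf_except E L V {} \<psi>" by (rule pcf_except_finish[OF \<psi>(1)]) (use \<psi>(2) in auto)
  then show False using no_coloring by blast
qed

text \<open>Unlike for two pairs, the color of \<open>x\<close> must also respect the harmful color
  for the fourth neighbor \<open>t\<close>, so \<open>ex_color_keeping\<close> has too few colors.
  If no choice leaves three colors at a first vertex, the color of \<open>t\<close> turns out to be
  unique around \<open>x\<close>.\<close>

lemma no_three_threads:
  assumes xy: "x \<in> B" "y \<in> B" "x \<noteq> y" and dx: "card (N x) = 4"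
    and t1: "thread E V x I1 y" and t2: "thread E V x I2 y" and t3: "thread E V x I3 y"
    and Nx: "N x = {hd (I1 @ [y]), hd (I2 @ [y]), hd (I3 @ [y]), t}"
    and dist: "distinct [hd (I1 @ [y]), hd (I2 @ [y]), hd (I3 @ [y]), t]" and ty: "t \<noteq> y"
    and I: "I1 \<noteq> []" "I2 \<noteq> []"
  shows False
proof -
  note V = branch_in_V[OF xy(1)] branch_in_V[OF xy(2)]
  define S where "S = {x} \<union> set I1 \<union> set I2 \<union> set I3"
  note int = thread_interior[OF t1] thread_interior[OF t2] thread_interior[OF t3]
  have SV: "S \<subseteq> V" using V int(1,5,9) by (auto simp: S_def)
  have xS: "x \<in> S" by (simp add: S_def)
  have yS: "y \<notin> S" using xy int(2,6,10) by (auto simp: S_def)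
  have x_int: "x \<notin> set I1" "x \<notin> set I2" "x \<notin> set I3" using xy int(2,6,10) by auto
  have disj: "set I1 \<inter> set I2 = {}" "set I1 \<inter> set I3 = {}" "set I2 \<inter> set I3 = {}"
    using thread_disjoint[OF t1 t2] thread_disjoint[OF t1 t3] thread_disjoint[OF t2 t3] xy dist by auto
  have tN: "t \<in> N x" using Nx by simp
  then have tV: "t \<in> V" "x \<in> N t" "t \<noteq> x" using N_sym[OF V(1)] in_N_iff N_irrefl by auto
  have t_int: "t \<notin> set J" if J: "thread E V x J y" "t \<noteq> hd (J @ [y])" for J
  proof
    assume "t \<in> set J"
    then have "t = hd J" "J \<noteq> []" using thread_ends(1)[OF J(1) xy] tV(2) by auto
    then show False using J(2) by simp
  qed
  have tI: "t \<notin> set I1" "t \<notin> set I2" "t \<notin> set I3" using t_int[OF t1] t_int[OF t2] t_int[OF t3] dist by auto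
  then have tS: "t \<notin> S" using tV by (auto simp: S_def)
  have "V - S \<subset> V" using xS SV by blast
  from ex_smaller[OF this] obtain \<phi> where \<phi>: "pcf_except E L (V - S) {} \<phi>" ..
  obtain f where f: "\<forall>\<psi>. (\<forall>m\<in>N t - {x}. \<psi> m = \<phi> m) \<longrightarrow> \<psi> x \<noteq> f \<longrightarrow> has_unique_color (N t) \<psi>"
    using ex_forbidden[OF tV(1,2), of \<phi>] ..
  have NxS: "N x - S \<subseteq> {y, t}"
    unfolding Nx S_def using first_in_thread[of I1 y] first_in_thread[of I2 y] first_in_thread[of I3 y] by blast
  define W where "W = V - S \<union> {x}"
  have WV: "W \<subseteq> V" using V by (auto simp: W_def)
  have W: "x \<in> W" "y \<in> W" "t \<in> W" using V yS tV tS by (auto simp: W_def)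
  have VW: "V = W \<union> set I1 \<union> set I2 \<union> set I3" using SV by (auto simp: W_def S_def)
  have WI: "set I1 \<inter> W = {}" "set I2 \<inter> W = {}" "set I3 \<inter> W = {}"
    using x_int by (auto simp: W_def S_def)
  \<comment> \<open>The colors for \<open>x\<close> that suit \<open>t\<close>, the condition at
    \<open>t\<close>, and \<open>y\<close>.\<close>
  define Q where "Q = L x - {\<phi> t, f, \<phi> y}"
  have L6: "6 \<le> card (L x)" using card_L[OF V(1)] dx by simp
  have center: "pcf_except E L W {x, y} (\<phi>(x := \<alpha>))" if \<alpha>: "\<alpha> \<in> Q" for \<alpha>
  proof -
    have "pcf_except E L W ({x} \<union> (N x - S)) (\<phi>(x := \<alpha>))"
      unfolding W_def using NxS \<alpha> by (intro recolor_center \<phi> xS SV) (auto simp: Q_def)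
    then have 1: "pcf_except E L W {x, y, t} (\<phi>(x := \<alpha>))" by (rule pcf_except_mono) (use NxS in auto)
    have avoid: "N t \<inter> set J = {}" if "thread E V x J y" "t \<notin> set J" for J
    proof -
      have False if m: "m \<in> N t" "m \<in> set J" for m
      proof -
        have "t \<in> N m" using N_sym[OF tV(1) m(1)] .
        then show False using thread_interior(3)[OF \<open>thread E V x J y\<close> m(2)] \<open>t \<notin> set J\<close> ty tV by blast
      qed
      then show ?thesis by blast
    qed
    have "N t \<subseteq> W" using VW avoid[OF t1] avoid[OF t2] avoid[OF t3] tI nb_subset[of E V t] by blast
    then have "nb E W t = N t" using WV by (auto simp: nb_def)
    moreover have "has_unique_color (N t) (\<phi>(x := \<alpha>))"
      by (rule f[THEN spec, THEN mp, THEN mp]) (use \<alpha> in \<open>auto simp: Q_def\<close>)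
    ultimately show ?thesis by (intro pcf_except_finish[OF 1]) auto
  qed
  \<comment> \<open>Stated for any order, so that each thread with inner vertices can be the
    last.\<close>
  have complete: "\<exists>\<psi>. (\<forall>w\<in>W. \<psi> w = (\<phi>(x := \<alpha>)) w) \<and> pcf_except E L V {x} \<psi> \<and>
      (3 \<le> card (L (hd J1) - {\<alpha>, \<phi> y}) \<longrightarrow> has_unique_color (N x) \<psi>)"
    if J: "thread E V x J1 y" "thread E V x J2 y" "thread E V x J3 y" "J1 \<noteq> []"
      and d: "set J1 \<inter> set J2 = {}" "set J1 \<inter> set J3 = {}" "set J2 \<inter> set J3 = {}"
        "set J1 \<inter> W = {}" "set J2 \<inter> W = {}" "set J3 \<inter> W = {}"
      and VJ: "V = W \<union> set J3 \<union> set J2 \<union> set J1" and \<alpha>: "\<alpha> \<in> Q" for J1 J2 J3 \<alpha>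
  proof -
    have c: "(\<phi>(x := \<alpha>)) x = \<alpha>" "(\<phi>(x := \<alpha>)) y = \<phi> y" "\<alpha> \<noteq> \<phi> y" using xy \<alpha> by (auto simp: Q_def)
    have "\<exists>\<psi>. (\<forall>w\<in>W. \<psi> w = (\<phi>(x := \<alpha>)) w) \<and> pcf_except E L (W \<union> set J3) {x, y} \<psi>"
      by (rule extend_thread'[OF J(3) xy center[OF \<alpha>]]) (use W WV d c in auto)
    then obtain \<phi>2 where \<phi>2: "\<forall>w\<in>W. \<phi>2 w = (\<phi>(x := \<alpha>)) w"
      and 2: "pcf_except E L (W \<union> set J3) {x, y} \<phi>2" by blast
    have c2: "\<phi>2 x = \<alpha>" "\<phi>2 y = \<phi> y" using \<phi>2 c W by auto
    have "\<exists>\<psi>. (\<forall>w\<in>W \<union> set J3. \<psi> w = \<phi>2 w) \<and> pcf_except E L (W \<union> set J3 \<union> set J2) {x, y} \<psi>"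
      by (rule extend_thread'[OF J(2) xy 2]) (use W VJ d c2 c in auto)
    then obtain \<phi>3 where \<phi>3: "\<forall>w\<in>W \<union> set J3. \<phi>3 w = \<phi>2 w"
      and 3: "pcf_except E L (W \<union> set J3 \<union> set J2) {x, y} \<phi>3" by blast
    have c3: "\<phi>3 x = \<alpha>" "\<phi>3 y = \<phi> y" using \<phi>3 c2 W by auto
    have "\<exists>\<psi>. (\<forall>w\<in>W \<union> set J3 \<union> set J2. \<psi> w = \<phi>3 w) \<and>
        pcf_except E L (W \<union> set J3 \<union> set J2 \<union> set J1) ({x, y} - {y}) \<psi> \<and>
        (3 \<le> card (L (hd J1) - {\<phi>3 x, \<phi>3 y}) \<longrightarrow> N x \<subseteq> W \<union> set J3 \<union> set J2 \<union> set J1 \<longrightarrow> has_unique_color (N x) \<psi>)"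
      by (rule finish_thread[OF J(1) xy J(4) 3]) (use W VJ d c3 c nb_subset[of E V y] in auto)
    then obtain \<psi> where \<psi>: "\<forall>w\<in>W \<union> set J3 \<union> set J2. \<psi> w = \<phi>3 w"
      "pcf_except E L V ({x, y} - {y}) \<psi>" "3 \<le> card (L (hd J1) - {\<alpha>, \<phi> y}) \<longrightarrow> has_unique_color (N x) \<psi>"
      using c3 nb_subset[of E V x] unfolding VJ[symmetric] by auto
    have "{x, y} - {y} = {x}" using xy by auto
    then show ?thesis using \<psi> \<phi>3 \<phi>2 by (intro exI[of _ \<psi>]) auto
  qed
  have finish: False if \<psi>: "pcf_except E L V {x} \<psi>" "has_unique_color (N x) \<psi>" for \<psi>
  proof -
    have "pcf_except E L V {} \<psi>" by (rule pcf_except_finish[OF \<psi>(1)]) (use \<psi>(2) in auto)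
    then show False using no_coloring by blast
  qed
  \<comment> \<open>Otherwise \<open>J\<close>, colored last, would settle \<open>x\<close>.\<close>
  have no: "card (L (hd J) - {\<alpha>, \<phi> y}) < 3" if J: "J \<in> {I1, I2, I3}" "J \<noteq> []" and \<alpha>: "\<alpha> \<in> Q" for J \<alpha>
  proof (rule ccontr)
    assume "\<not> ?thesis"
    then have k: "3 \<le> card (L (hd J) - {\<alpha>, \<phi> y})" by simp
    from J(1) consider "J = I1" | "J = I2" | "J = I3" by blast
    then show False
    proof cases
      case 1
      then show ?thesis
        using complete[OF t1 t2 t3 I(1) disj(1,2,3) WI(1,2,3) _ \<alpha>] VW k finish by (auto simp: Un_ac)
    next
      case 2
      then show ?thesis
        using complete[OF t2 t1 t3 I(2) _ disj(3,2) WI(2,1,3) _ \<alpha>] disj(1) VW k finish by (auto simp: Un_ac Int_commute)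
    next
      case 3
      then show ?thesis
        using complete[OF t3 t1 t2 _ _ _ disj(1) WI(3,1,2) _ \<alpha>] disj(2,3) J(2) VW k finish by (auto simp: Un_ac Int_commute)
    qed
  qed
  have cardQ: "3 \<le> card Q" using card_Diff_set_ge[of 3 "[\<phi> t, f, \<phi> y]" "L x"] L6 by (simp add: Q_def)
  then have "Q \<noteq> {}" by auto
  then obtain \<alpha> where \<alpha>: "\<alpha> \<in> Q" by blast
  \<comment> \<open>The list has exactly four colors, including \<open>\<phi> y\<close> and all of
    \<open>Q\<close>. With \<open>\<phi> t\<close> in it as well, these four and \<open>f\<close>
    would contain all six colors of \<open>x\<close>.\<close>
  have avoid: "\<phi> t \<notin> L (hd J) \<and> \<phi> y \<in> L (hd J)" if J: "J \<in> {I1, I2, I3}" "J \<noteq> []" for J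
  proof -
    have "hd J \<in> set J" using J by simp
    then have L4: "4 \<le> card (L (hd J))" using J(1) int(4,8,12) by blast
    then have fin: "finite (L (hd J))" by (auto intro: card_ge_0_finite)
    have mem: "\<beta> \<in> L (hd J) \<and> \<phi> y \<in> L (hd J) \<and> card (L (hd J)) \<le> 4" if "\<beta> \<in> Q" for \<beta>
    proof (rule ccontr)
      assume a: "\<not> ?thesis"
      have "3 \<le> card (L (hd J) - {\<beta>, \<phi> y})"
      proof (cases "card (L (hd J)) \<le> 4")
        case True
        then have "L (hd J) - {\<beta>, \<phi> y} = L (hd J) - set [\<beta>] \<or> L (hd J) - {\<beta>, \<phi> y} = L (hd J) - set [\<phi> y]"
          using a by auto
        moreover have "3 \<le> card (L (hd J) - set [z])" for z by (rule card_Diff_set_ge) (use L4 in simp)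
        ultimately show ?thesis by metis
      next
        case False
        then show ?thesis using card_Diff_set_ge[of 3 "[\<beta>, \<phi> y]" "L (hd J)"] by simp
      qed
      then show False using no[OF J that] by simp
    qed
    have "\<phi> t \<notin> L (hd J)"
      using notin_if_remaining_subset[of "L x" "L (hd J)" "\<phi> y" "\<phi> t" f] L6 fin mem mem[OF \<alpha>]
      by (auto simp: Q_def)
    then show ?thesis using mem[OF \<alpha>] by simp
  qed
  obtain \<psi> where \<psi>: "\<forall>w\<in>W. \<psi> w = (\<phi>(x := \<alpha>)) w" "pcf_except E L V {x} \<psi>"
    using complete[OF t1 t2 t3 I(1) disj(1,2,3) WI(1,2,3) _ \<alpha>] VW by (auto simp: Un_ac)
  have \<psi>t: "\<psi> t = \<phi> t" "\<psi> y = \<phi> y" using \<psi>(1) W tV(3) xy(3) by auto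
  have "\<psi> (hd (J @ [y])) \<noteq> \<psi> t" if J: "J \<in> {I1, I2, I3}" for J
  proof (cases "J = []")
    \<comment> \<open>The neighbor is \<open>y\<close>, whose color lies in the list of the first
      vertex of \<open>I1\<close>, while that of \<open>t\<close> does not.\<close>
    case True
    then show ?thesis using avoid[of I1] I(1) \<psi>t by auto
  next
    case False
    then have "hd J \<in> set J" by simp
    then have "hd J \<in> V" using J int(1,5,9) by blast
    then have "\<psi> (hd J) \<in> L (hd J)" using \<psi>(2) by (auto simp: pcf_except_def)
    then show ?thesis using avoid[OF J False] \<psi>t False by auto
  qed
  then have "has_unique_color (N x) \<psi>"
    unfolding Nx by (intro has_unique_colorI[of t]) auto
  then show False using finish[OF \<psi>(2)] by simp
qed

end

section \<open>Contracting the threads\<close>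

context min_counterexample
begin

lemma degree_2_nbs:
  assumes "v \<in> V" "v \<notin> B" "u \<in> N v"
  shows "\<exists>w. N v = {u, w} \<and> w \<in> V \<and> w \<noteq> u"
proof -
  have "card (N v) = 2" using degree_ge_2[OF assms(1)] assms(1,2) by (auto simp: branch_def)
  then obtain p q where "N v = {p, q}" "p \<noteq> q" by (auto simp: card_2_iff)
  then have "\<exists>w. N v = {u, w} \<and> w \<noteq> u" using assms(3) by auto
  then show ?thesis using in_N_iff by auto
qed

text \<open>The bound is 3, the form in which \<open>no_triangle\<close> asks for it, although the
  degree is at most 2.\<close>

lemma degree_le_2: "v \<in> V \<Longrightarrow> v \<notin> B \<Longrightarrow> card (N v) \<le> 3"
  by (auto simp: branch_def)

text \<open>Follow the 2-vertices starting at \<open>a\<close>. A return to \<open>x\<close> is a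
  triangle or a pendant four-cycle, and a fourth inner vertex is impossible by
  \<open>no_four_consecutive\<close>.\<close>

lemma ex_thread:
  assumes x: "x \<in> B" and a: "a \<in> N x"
  shows "\<exists>I y. y \<in> B \<and> y \<noteq> x \<and> thread E V x I y \<and> hd (I @ [y]) = a"
proof (cases "a \<in> B")
  case True
  then show ?thesis
    using a irr by (intro exI[of _ "[]"] exI[of _ a]) (auto intro: thread0 simp: in_N_iff)
next
  case aB: False
  have xV: "x \<in> V" using branch_in_V[OF x] .
  have aV: "a \<in> V" using a in_N_iff by simp
  obtain b where b: "N a = {x, b}" "b \<in> V" "b \<noteq> x" using degree_2_nbs[OF aV aB N_sym[OF xV a]] by blast
  have ab: "a \<in> N b" using N_sym[OF aV, of b] b by simp
  show ?thesis
  proof (cases "b \<in> B")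
    case True
    then show ?thesis
      using b aV by (intro exI[of _ "[a]"] exI[of _ b]) (auto intro: thread1)
  next
    case bB: False
    obtain c where c: "N b = {a, c}" "c \<in> V" "c \<noteq> a" using degree_2_nbs[OF b(2) bB ab] by blast
    have bc: "b \<in> N c" using N_sym[OF b(2), of c] c by simp
    have cx: "c \<noteq> x"
    proof
      assume "c = x"
      then have "E b x" using c(1) in_N_iff[of x b] by simp
      then show False
        using no_triangle[of a b x] aV b(1) degree_le_2[OF b(2) bB] by (simp add: insert_commute)
    qed
    show ?thesis
    proof (cases "c \<in> B")
      case True
      then show ?thesis
        using b c aV cx by (intro exI[of _ "[a, b]"] exI[of _ c]) (auto intro: thread2)
    next
      case cB: False
      obtain d where d: "N c = {b, d}" "d \<in> V" "d \<noteq> b" using degree_2_nbs[OF c(2) cB bc] by blast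
      have cd: "c \<in> N d" using N_sym[OF c(2), of d] d by simp
      have dB: "d \<in> B"
      proof (rule ccontr)
        assume dB: "d \<notin> B"
        obtain e where e: "N d = {c, e}" using degree_2_nbs[OF d(2) dB cd] by blast
        have "a \<noteq> d" using cd b(1) cx bc N_irrefl[of b] by auto
        then show False using no_four_consecutive[of a x b c d e] aV b c d e by blast
      qed
      have "d \<noteq> x"
      proof
        assume dx: "d = x"
        have "card (N x) \<noteq> 3" using no_thread_at_degree_3[of a x b c] aV b c cx by blast
        then have "card (N x) = 4" using N_le_4[OF xV] x by (auto simp: branch_def)
        then show False using no_pendant_four_cycle[of a x b c] aV b c d dx by blast
      qed
      then show ?thesis
        using b c d aV dB by (intro exI[of _ "[a, b, c]"] exI[of _ d]) (auto intro: thread3)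
    qed
  qed
qed

text \<open>Otherwise \<open>v\<close>, \<open>d\<close> and their other neighbors are four
  consecutive 2-vertices.\<close>

lemma ex_branch_near_neighbor:
  assumes v: "v \<in> V" "v \<notin> B" and nB: "N v \<inter> B = {}" and d: "d \<in> N v"
  shows "N d \<inter> B \<noteq> {}"
proof
  assume dB: "N d \<inter> B = {}"
  have dV: "d \<in> V" "d \<notin> B" using d nB in_N_iff by auto
  have vd: "v \<in> N d" using N_sym[OF v(1) d] .
  obtain e where e: "N v = {d, e}" "e \<in> V" "e \<noteq> d" using degree_2_nbs[OF v d] by blast
  obtain u where u: "N d = {v, u}" "u \<in> V" "u \<noteq> v" using degree_2_nbs[OF dV vd] by blast
  have uB: "u \<notin> B" "e \<notin> B" using dB nB u e by auto
  have du: "d \<in> N u" using N_sym[OF dV(1), of u] u by simp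
  have ve: "v \<in> N e" using N_sym[OF v(1), of e] e by simp
  obtain w where w: "N u = {d, w}" using degree_2_nbs[OF u(2) uB(1) du] by blast
  obtain z where z: "N e = {v, z}" using degree_2_nbs[OF e(2) uB(2) ve] by blast
  have "u \<noteq> e"
  proof
    assume "u = e"
    then have "E d e" using u(1) in_N_iff[of u d] by simp
    then show False using no_triangle[of v d e] v(1) e(1) degree_le_2[OF dV] by blast
  qed
  then show False
    using no_four_consecutive[of u w d v e z] u v e dV w z by (simp add: insert_commute)
qed

lemma branch_nonempty: "B \<noteq> {}"
proof
  assume B: "B = {}"
  have "V \<noteq> {}"
  proof
    assume "V = {}"
    then have "pcf_except E L V {} \<phi>" for \<phi> by (simp add: pcf_except_def)
    then show False using no_coloring by blast
  qed
  then obtain v where v: "v \<in> V" by blast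
  then have "N v \<noteq> {}" using degree_ge_2[of v] by auto
  then obtain d where "d \<in> N v" by blast
  then show False using ex_branch_near_neighbor[of v d] v B by simp
qed

section \<open>The contracted graph on the branch vertices\<close>

definition thread_adj :: "'a \<Rightarrow> 'a \<Rightarrow> bool" where
  "thread_adj x y \<longleftrightarrow> x \<in> B \<and> y \<in> B \<and> x \<noteq> y \<and> (\<exists>I. thread E V x I y)"

lemma sgraph_thread_adj: "sgraph thread_adj"
  by unfold_locales (auto simp: thread_adj_def dest: thread_rev)

text \<open>\<open>branch_of\<close> is the contraction map: only the middle vertex of a thread with three inner vertices
  has no branch vertex as a neighbor, and it is sent to the same branch vertex as one of its
  neighbors. On branch vertices both maps are the identity; elsewhere \<open>near_branch\<close> is used only
  for vertices with a branch neighbor.\<close>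
definition near_branch :: "'a \<Rightarrow> 'a" where
  "near_branch v = (if v \<in> B then v else SOME b. b \<in> N v \<inter> B)"

definition branch_of :: "'a \<Rightarrow> 'a" where
  "branch_of v = (if v \<in> B \<or> N v \<inter> B \<noteq> {} then near_branch v else near_branch (SOME u. u \<in> N v))"

lemma near_branch_in: "v \<notin> B \<Longrightarrow> N v \<inter> B \<noteq> {} \<Longrightarrow> near_branch v \<in> N v \<inter> B"
  unfolding near_branch_def using some_in_eq[of "N v \<inter> B"] by simp

lemma branch_of_far:
  assumes "v \<in> V" "v \<notin> B" "N v \<inter> B = {}"
  shows "\<exists>u\<in>N v. u \<notin> B \<and> N u \<inter> B \<noteq> {} \<and> branch_of v = near_branch u \<and> branch_of u = near_branch u"
proof -
  have "N v \<noteq> {}" using degree_ge_2[OF assms(1)] by auto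
  then have u: "(SOME u. u \<in> N v) \<in> N v" by (simp add: some_in_eq)
  then show ?thesis
    using ex_branch_near_neighbor[OF assms u] assms by (intro bexI[OF _ u]) (auto simp: branch_of_def)
qed

text \<open>Every fibre of \<open>branch_of\<close> is connected to its branch vertex in at most two
  steps, and along each thread some edge passes from the fibre of \<open>x\<close> to that of
  \<open>y\<close>. With three inner vertices its position depends on where the middle one is
  sent.\<close>

lemma K4_minor_if_K4_minor_thread_adj:
  assumes "K4_minor thread_adj B"
  shows "K4_minor E V"
proof (rule K4_minor_contraction[OF assms])
  have sB: "branch_of b = b" if "b \<in> B" for b using that by (simp add: branch_of_def near_branch_def)
  have near: "branch_of v = near_branch v" if "N v \<inter> B \<noteq> {}" for v using that by (simp add: branch_of_def)
  fix x assume x: "x \<in> B"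
  let ?F = "{v \<in> V. branch_of v = x}"
  let ?R = "\<lambda>a b. E a b \<and> a \<in> ?F \<and> b \<in> ?F"
  have xF: "x \<in> ?F" using sB x branch_in_V by simp
  have step: "?R x v" if v: "v \<in> V" "v \<notin> B" "N v \<inter> B \<noteq> {}" "branch_of v = x" for v
  proof -
    have "x \<in> N v" using near_branch_in[OF v(2,3)] near[OF v(3)] v(4) by auto
    then have "E x v" using sym by (auto simp: nb_def)
    then show ?thesis using v xF by simp
  qed
  show "conn E ?F"
  proof (rule conn_if_reachable[OF xF])
    fix v assume v: "v \<in> ?F"
    show "?R\<^sup>*\<^sup>* x v"
    proof (cases "v \<in> B \<or> N v \<inter> B \<noteq> {}")
      case True
      then show ?thesis
      proof (cases "v \<in> B")
        case True
        then show ?thesis using v sB by simp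
      next
        case False
        then show ?thesis using True v step[of v] by blast
      qed
    next
      case False
      then obtain u where u: "u \<in> N v" "u \<notin> B" "N u \<inter> B \<noteq> {}" "branch_of v = near_branch u" "branch_of u = near_branch u"
        using branch_of_far[of v] v by auto
      have uV: "u \<in> V" "E u v" using u(1) sym by (auto simp: nb_def)
      have su: "branch_of u = x" using u v by simp
      have xu: "?R x u" by (rule step[OF uV(1) u(2,3) su])
      have uv: "?R u v" using v uV su by simp
      show ?thesis by (rule rtranclp.rtrancl_into_rtrancl[of ?R, OF r_into_rtranclp[of ?R, OF xu] uv])
    qed
  qed
next
  have sB: "branch_of b = b" if "b \<in> B" for b using that by (simp add: branch_of_def near_branch_def)
  have nearB: "branch_of v \<in> N v \<inter> B" if "v \<notin> B" "N v \<inter> B \<noteq> {}" for v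
    using near_branch_in[OF that] that(2) by (simp add: branch_of_def)
  fix x y assume xy: "x \<in> B" "y \<in> B" "thread_adj x y"
  then obtain I where I: "thread E V x I y" and neq: "x \<noteq> y" by (auto simp: thread_adj_def)
  have V: "x \<in> V" "y \<in> V" using xy branch_in_V by auto
  have int: "s \<notin> B" if "s \<in> set I" for s using thread_interior(2)[OF I that] .
  from I show "\<exists>u\<in>V. \<exists>v\<in>V. branch_of u = x \<and> branch_of v = y \<and> E u v"
  proof cases
    case thread0
    then show ?thesis using V sB xy by (intro bexI[of _ x] bexI[of _ y]) auto
  next
    case (thread1 a)
    then have e: "E x a" "E a y" using sym in_N_iff[of x a] in_N_iff[of y a] by auto
    have "branch_of a \<in> N a \<inter> B" by (rule nearB) (use thread1 int xy in auto)
    then have "branch_of a = x \<or> branch_of a = y" using thread1(3) by auto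
    then show ?thesis
    proof
      assume "branch_of a = x"
      then show ?thesis using e V thread1(2) sB[OF xy(2)] by (intro bexI[of _ a] bexI[of _ y]) auto
    next
      assume "branch_of a = y"
      then show ?thesis using e V thread1(2) sB[OF xy(1)] by (intro bexI[of _ x] bexI[of _ a]) auto
    qed
  next
    case (thread2 a b)
    have nB: "a \<notin> B" "b \<notin> B" using int thread2(1) by auto
    have "E a b" using thread2(4) in_N_iff[of b a] by auto
    moreover have "branch_of a \<in> N a \<inter> B" by (rule nearB) (use nB thread2(4) xy in auto)
    then have "branch_of a = x" using thread2(4) nB by auto
    moreover have "branch_of b \<in> N b \<inter> B" by (rule nearB) (use nB thread2(5) xy in auto)
    then have "branch_of b = y" using thread2(5) nB by auto
    ultimately show ?thesis using thread2(2,3) by (intro bexI[of _ a] bexI[of _ b]) auto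
  next
    case (thread3 a b c)
    have nB: "a \<notin> B" "b \<notin> B" "c \<notin> B" using int thread3(1) by auto
    have e: "E a b" "E b c" using thread3(5,6) in_N_iff[of b a] in_N_iff[of c b] by auto
    have "branch_of a \<in> N a \<inter> B" by (rule nearB) (use nB thread3(5) xy in auto)
    then have a: "branch_of a = x" using thread3(5) nB by auto
    have "branch_of c \<in> N c \<inter> B" by (rule nearB) (use nB thread3(7) xy in auto)
    then have c: "branch_of c = y" using thread3(7) nB by auto
    have "N b \<inter> B = {}" using thread3(6) nB by simp
    from branch_of_far[OF thread3(3) nB(2) this] obtain u where "u \<in> N b" "branch_of b = near_branch u" "branch_of u = near_branch u" by blast
    then have "branch_of b = x \<or> branch_of b = y" using thread3(6) a c by auto
    then show ?thesis
    proof
      assume "branch_of b = x"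
      then show ?thesis using e c thread3(3,4) by (intro bexI[of _ b] bexI[of _ c]) auto
    next
      assume "branch_of b = y"
      then show ?thesis using e a thread3(2,3) by (intro bexI[of _ a] bexI[of _ b]) auto
    qed
  qed
qed

text \<open>An edge and a one-vertex thread form a triangle, two one-vertex threads are twins, and
  two edges have the same first vertex.\<close>

lemma no_parallel_threads_at_degree_3:
  assumes x: "x \<in> B" "card (N x) = 3" and y: "y \<in> B" "x \<noteq> y"
    and I: "thread E V x I y" "thread E V x J y" "hd (I @ [y]) \<noteq> hd (J @ [y])"
  shows False
proof -
  have short: "length K \<le> 1" if "thread E V x K y" for K
    using long_thread_degree[OF thread_rev[OF that] x(1)] y(2) x(2) by fastforce
  have edge: False if "thread E V x [] y" "thread E V x [v] y" for v
  proof -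
    have "E x y" using that(1) by cases
    moreover have "v \<in> V \<and> N v = {x, y}" using that(2) by cases auto
    ultimately show False using no_triangle[of v x y] x(2) by auto
  qed
  have twins: False if "thread E V x [v] y" "thread E V x [w] y" "v \<noteq> w" for v w
  proof -
    have "v \<in> V \<and> N v = {x, y}" using that(1) by cases auto
    moreover have "w \<in> V \<and> N w = {x, y}" using that(2) by cases auto
    ultimately show False using no_twins_at_degree_3[of v x y w] x(2) that(3) by auto
  qed
  have "I = [] \<or> (\<exists>v. I = [v])" "J = [] \<or> (\<exists>v. J = [v])"
    using short[OF I(1)] short[OF I(2)] by (auto simp: le_Suc_eq length_Suc_conv)
  then show False using I edge twins by auto
qed

theorem K4_minor_host: "K4_minor E V"
proof (rule ccontr)
  assume noK4: "\<not> K4_minor E V"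
  have finB: "finite B" using finV by (simp add: branch_def)
  have "\<exists>x\<in>B. card (nb thread_adj B x) \<le> 2"
  proof (rule ccontr)
    assume "\<not> ?thesis"
    then have "K4_minor thread_adj B"
      using branch_nonempty by (intro K4_minor_if_clique_degree[OF sgraph_thread_adj finB, of "{}"]) auto
    then show False using K4_minor_if_K4_minor_thread_adj noK4 by blast
  qed
  then obtain x where x: "x \<in> B" "card (nb thread_adj B x) \<le> 2" by blast
  have xV: "x \<in> V" using branch_in_V[OF x(1)] .
  have "\<forall>a\<in>N x. \<exists>p. snd p \<in> B \<and> snd p \<noteq> x \<and> thread E V x (fst p) (snd p) \<and> hd (fst p @ [snd p]) = a"
    using ex_thread[OF x(1)] by auto
  from bchoice[OF this] obtain p where p: "\<forall>a\<in>N x. snd (p a) \<in> B \<and> snd (p a) \<noteq> x \<and>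
      thread E V x (fst (p a)) (snd (p a)) \<and> hd (fst (p a) @ [snd (p a)]) = a" ..
  define I where "I = (\<lambda>a. fst (p a))"
  define e where "e = (\<lambda>a. snd (p a))"
  have e: "e a \<in> B" "e a \<noteq> x" "thread E V x (I a) (e a)" "hd (I a @ [e a]) = a" if "a \<in> N x" for a
    using p that by (auto simp: I_def e_def)
  have e_im: "e ` N x \<subseteq> nb thread_adj B x" using e x(1) by (auto simp: nb_def thread_adj_def)
  have fin_im: "finite (nb thread_adj B x)" using finite_subset[OF nb_subset finB] .
  have "card (N x) = 3 \<or> card (N x) = 4" using x(1) N_le_4[OF xV] by (auto simp: branch_def)
  then show False
  proof
    assume d3: "card (N x) = 3"
    have "card (e ` N x) \<le> 2" using card_mono[OF fin_im e_im] x(2) by simp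
    then have "\<not> inj_on e (N x)" using d3 card_image[of e "N x"] by auto
    then obtain a a' where a: "a \<in> N x" "a' \<in> N x" "a \<noteq> a'" "e a = e a'" by (auto simp: inj_on_def)
    show False
      using no_parallel_threads_at_degree_3[OF x(1) d3 e(1)[OF a(1)] e(2)[OF a(1), symmetric] e(3)[OF a(1)], of "I a'"]
        e(3,4)[OF a(2)] e(4)[OF a(1)] a(3,4) by simp
  next
    assume d4: "card (N x) = 4"
    define P where "P = (\<lambda>y. {a \<in> N x. e a = y})"
    have P_sub: "P y \<subseteq> N x" for y by (auto simp: P_def)
    have P: "a \<in> N x" "e a = y" if "a \<in> P y" for a y using that by (auto simp: P_def)
    have interior: "I a \<noteq> []" if "a \<in> P y" "a \<noteq> y" for a y
      using e(4)[OF P(1)[OF that(1)]] P(2)[OF that(1)] that(2) by auto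
    \<comment> \<open>A branch vertex next to \<open>x\<close> can only start the thread that is an
      edge.\<close>
    have self: "y \<in> P y" if "y \<in> N x" "y \<in> B" for y
    proof -
      have "I y = []"
      proof (rule ccontr)
        assume ne: "I y \<noteq> []"
        then have "y \<in> set (I y)" using e(4)[OF that(1)] hd_in_set[OF ne] by simp
        then show False using thread_interior(2)[OF e(3)[OF that(1)]] that(2) by blast
      qed
      then show ?thesis using e(4)[OF that(1)] that(1) by (simp add: P_def)
    qed
    have three: False if c: "3 \<le> card (P y)" for y
    proof -
      have finP: "finite (P y)" using finite_subset[OF P_sub finN] .
      obtain a1 where a1: "a1 \<in> P y" "a1 \<notin> set [y]" using ex_notin_if_card_gt[of "[y]" "P y"] c by auto
      obtain a2 where a2: "a2 \<in> P y" "a2 \<notin> set [y, a1]" using ex_notin_if_card_gt[of "[y, a1]" "P y"] c by auto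
      \<comment> \<open>If one of the threads is an edge, it is put third: the first two then have
        inner vertices, and the fourth neighbor \<open>t\<close> differs from
        \<open>y\<close>.\<close>
      have "\<exists>a3\<in>P y. a3 \<noteq> a1 \<and> a3 \<noteq> a2 \<and> (y \<in> P y \<longrightarrow> a3 = y)"
      proof (cases "y \<in> P y")
        case True
        then show ?thesis using a1 a2 by auto
      next
        case False
        then show ?thesis using ex_notin_if_card_gt[of "[a1, a2]" "P y"] c by auto
      qed
      then obtain a3 where a3: "a3 \<in> P y" "a3 \<noteq> a1" "a3 \<noteq> a2" "y \<in> P y \<longrightarrow> a3 = y" by blast
      obtain t where t: "t \<in> N x" "t \<notin> set [a1, a2, a3]"
        using ex_notin_if_card_gt[of "[a1, a2, a3]" "N x"] d4 by auto
      have yB: "y \<in> B" "y \<noteq> x" using e(1,2)[OF P(1)[OF a1(1)]] P(2)[OF a1(1)] by auto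
      have ty: "t \<noteq> y" using self[of y] yB t a3(4) by auto
      have Nx: "N x = {a1, a2, a3, t}"
      proof (rule card_seteq[OF finN, symmetric])
        show "{a1, a2, a3, t} \<subseteq> N x" using P_sub a1(1) a2(1) a3(1) t(1) by blast
        show "card (N x) \<le> card {a1, a2, a3, t}" using d4 a1 a2 a3 t by auto
      qed
      have h: "hd (I a @ [y]) = a" "thread E V x (I a) y" if "a \<in> P y" for a
        using e(3,4)[OF P(1)[OF that]] P(2)[OF that] by auto
      show False
        using no_three_threads[OF x(1) yB(1) yB(2)[symmetric] d4 h(2)[OF a1(1)] h(2)[OF a2(1)] h(2)[OF a3(1)], of t]
          interior[OF a1(1)] interior[OF a2(1)] h(1)[OF a1(1)] h(1)[OF a2(1)] h(1)[OF a3(1)] a1(2) a2(2) a3(2,3) t(2) ty Nx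
        by auto
    qed
    obtain zs where zs: "set zs = nb thread_adj B x" "distinct zs" using finite_distinct_list[OF fin_im] by blast
    then have "length zs \<le> 2" using x(2) distinct_card[of zs] by simp
    \<comment> \<open>The pair is padded if there are fewer than two ends; the counts below exclude
      this.\<close>
    then have "\<exists>y z. set zs \<subseteq> {y, z}"
      by (cases zs; cases "tl zs") auto
    then obtain y z where yz: "nb thread_adj B x \<subseteq> {y, z}" unfolding zs(1) by blast
    have union: "N x = P y \<union> P z" using e_im yz by (auto simp: P_def)
    then have "4 \<le> card (P y) + card (P z)" using d4 card_Un_le[of "P y" "P z"] by simp
    moreover have "\<not> 3 \<le> card (P y)" "\<not> 3 \<le> card (P z)" using three by blast+
    ultimately have two: "card (P y) = 2" "card (P z) = 2" by auto
    have neq: "y \<noteq> z" using union two d4 by auto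
    obtain a1 where a1: "a1 \<in> P y" "a1 \<notin> set [y]" using ex_notin_if_card_gt[of "[y]" "P y"] two by auto
    obtain a2 where a2: "a2 \<in> P y" "a2 \<notin> set [a1]" using ex_notin_if_card_gt[of "[a1]" "P y"] two by auto
    obtain a3 where a3: "a3 \<in> P z" "a3 \<notin> set [z]" using ex_notin_if_card_gt[of "[z]" "P z"] two by auto
    obtain a4 where a4: "a4 \<in> P z" "a4 \<notin> set [a3]" using ex_notin_if_card_gt[of "[a3]" "P z"] two by auto
    have Py: "P y = {a1, a2}"
      by (rule card_seteq[symmetric]) (use a1 a2 two finite_subset[OF P_sub finN] in auto)
    have Pz: "P z = {a3, a4}"
      by (rule card_seteq[symmetric]) (use a3 a4 two finite_subset[OF P_sub finN] in auto)
    have disj: "P y \<inter> P z = {}" using neq by (auto simp: P_def)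
    have yB: "y \<in> B" "y \<noteq> x" using e(1,2)[OF P(1)[OF a1(1)]] P(2)[OF a1(1)] by auto
    have zB: "z \<in> B" "z \<noteq> x" using e(1,2)[OF P(1)[OF a3(1)]] P(2)[OF a3(1)] by auto
    have h: "hd (I a @ [w]) = a" "thread E V x (I a) w" if "a \<in> P w" for a w
      using e(3,4)[OF P(1)[OF that]] P(2)[OF that] by auto
    have Nx: "N x = {a1, a2, a3, a4}" using union Py Pz by auto
    have dist: "distinct [a1, a2, a3, a4]" using a1 a2 a3 a4 disj by auto
    show False
      using no_two_pairs[OF x(1) yB(1) zB(1) yB(2)[symmetric] zB(2)[symmetric] neq d4
          h(2)[OF a1(1)] h(2)[OF a2(1)] h(2)[OF a3(1)] h(2)[OF a4(1)]]
        h(1)[OF a1(1)] h(1)[OF a2(1)] h(1)[OF a3(1)] h(1)[OF a4(1)] Nx dist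
        interior[OF a1(1)] interior[OF a3(1)] a1(2) a3(2) by simp
  qed
qed

end

theorem ex_pcf_coloring:
  fixes E :: "'a \<Rightarrow> 'a \<Rightarrow> bool" and L :: "'a \<Rightarrow> 'c set"
  assumes "sgraph E" "list_ok E L V" "\<not> K4_minor E V"
  shows "\<exists>\<phi>. pcf_except E L V {} \<phi>"
  using assms(2,3)
proof (induction "card V" arbitrary: V L rule: less_induct)
  case less
  show ?case
  proof (rule ccontr)
    assume no: "\<not> ?thesis"
    have "min_counterexample E L V"
    proof (intro min_counterexample.intro min_counterexample_axioms.intro)
      fix W and L' :: "'a \<Rightarrow> 'c set" assume W: "W \<subset> V" "list_ok E L' W"
      have "card W < card V" using less.prems(1) W(1) by (intro psubset_card_mono) (auto simp: list_ok_def)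
      moreover have "\<not> K4_minor E W" using less.prems(2) K4_minor_mono W(1) by blast
      ultimately show "\<exists>\<phi> :: 'a \<Rightarrow> 'c. pcf_except E L' W {} \<phi>" using less.hyps W(2) by blast
    qed (use assms(1) less.prems no in auto)
    then show False using min_counterexample.K4_minor_host less.prems(2) by blast
  qed
qed

section \<open>Transfer to \<open>pair_graph\<close>\<close>

lemma connected_induce_if_conn:
  assumes "conn E A" and E: "E = (\<lambda>u v. (u, v) \<in> parcs G)"
  shows "connected (with_proj G \<restriction> A)"
proof -
  let ?S = "mk_symmetric (with_proj G \<restriction> A)"
  have arc: "(u, v) \<in> parcs ?S" if "E u v" "u \<in> A" "v \<in> A" for u v
  proof -
    have "(u, v) \<in> arcs (with_proj G \<restriction> A)" using that E by simp
    then show ?thesis unfolding parcs_mk_symmetric by (rule UN_I) simp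
  qed
  have "(x, y) \<in> rtrancl_on A (parcs ?S)" if "x \<in> A" "y \<in> A" for x y
  proof -
    have "(\<lambda>a b. E a b \<and> a \<in> A \<and> b \<in> A)\<^sup>*\<^sup>* x y" using assms(1) that by (simp add: conn_def)
    then show ?thesis
    proof (induction)
      case base
      then show ?case using that by auto
    next
      case (step y z)
      then show ?case using arc by (auto intro: rtrancl_on_into_rtrancl_on)
    qed
  qed
  moreover have "A \<noteq> {}" using assms(1) by (simp add: conn_def)
  ultimately show ?thesis
    by (simp add: connected_def strongly_connected_def reachable_def)
qed

lemma closed_set_eq_pverts:
  assumes "pair_graph G" "connected (with_proj G)" "A \<subseteq> pverts G" "A \<noteq> {}"
    and closed: "\<And>u v. u \<in> A \<Longrightarrow> (u, v) \<in> parcs G \<Longrightarrow> v \<in> A"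
  shows "A = pverts G"
proof -
  interpret pair_graph G by fact
  have sym: "(v, u) \<in> parcs G" if "(u, v) \<in> parcs G" for u v
    using pair_sym_arcs that by (auto simp: symmetric_def dest: symD)
  obtain a where a: "a \<in> A" using assms(4) by blast
  have "v \<in> A" if "v \<in> pverts G" for v
  proof -
    have "(a, v) \<in> rtrancl_on (pverts G) (parcs (mk_symmetric (with_proj G)))"
      using assms(2) that a assms(3) by (auto simp: connected_def strongly_connected_def reachable_def)
    then show ?thesis
    proof (induction rule: rtrancl_on_induct)
      case base
      show ?case by (rule a)
    next
      case (step y z)
      then have "(y, z) \<in> parcs G" using sym by (auto simp: parcs_mk_symmetric)
      then show ?case using closed step by blast
    qed
  qed
  then show ?thesis using assms(3) by blast
qed

lemma iso_cycle_graph_5: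
  assumes G: "pair_graph G" and dist: "distinct [a, b, c, d, e]" and V: "pverts G = {a, b, c, d, e}"
    and nbs: "neighborhood G a = {e, b}" "neighborhood G b = {a, c}" "neighborhood G c = {b, d}"
      "neighborhood G d = {c, e}" "neighborhood G e = {d, a}"
  shows "digraph_iso (with_proj G) (with_proj (cycle_graph 5))"
proof -
  interpret G: pair_graph G by fact
  interpret C: pair_graph "cycle_graph 5" by (rule pair_graph_cycle_graph) simp
  define f :: "'a \<Rightarrow> nat" where
    "f v = (if v = a then 0 else if v = b then 1 else if v = c then 2 else if v = d then 3 else 4)" for v
  have f: "f a = 0" "f b = 1" "f c = 2" "f d = 3" "f e = 4" using dist by (auto simp: f_def)
  have five: "{..<5::nat} = {0, 1, 2, 3, 4}" by auto
  have "bij_betw f (pverts G) (pverts (cycle_graph 5))"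
    unfolding V bij_betw_def by (auto simp: inj_on_def f cycle_graph_def five)
  moreover have "(u, v) \<in> parcs G \<longleftrightarrow> (f u, f v) \<in> parcs (cycle_graph 5)"
    if "u \<in> pverts G" "v \<in> pverts G" for u v
  proof -
    have "(u, v) \<in> parcs G \<longleftrightarrow> v \<in> neighborhood G u" by (simp add: neighborhood_def)
    also have "\<dots> \<longleftrightarrow> (f u, f v) \<in> parcs (cycle_graph 5)"
      using that unfolding V
      by (elim insertE emptyE; hypsubst; use dist in \<open>simp add: nbs f cycle_graph_def; fastforce?\<close>)
    finally show ?thesis .
  qed
  ultimately show ?thesis
    using digraph_iso_with_proj_iff[OF G.pair_wf_digraph_axioms C.pair_wf_digraph_axioms] by blast
qed

theorem theorem1p6:
  fixes G :: "'a pair_pre_digraph"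
  assumes "pair_graph G"
    and "connected (with_proj G)"
    and "\<not> is_minor (complete_graph 4) G"
    and "max_degree G \<le> 4"
    and "\<not> digraph_iso (with_proj G) (with_proj (cycle_graph 5))"
  shows "pcf_degree_plus_choosable TYPE('c) 2 G"
  unfolding pcf_degree_plus_choosable_def
proof (intro allI impI)
  interpret pair_graph G by fact
  fix L :: "'a \<Rightarrow> 'c set"
  assume L: "\<forall>v\<in>pverts G. finite (L v) \<and> card (L v) = degree G v + 2"
  define E where "E = (\<lambda>u v. (u, v) \<in> parcs G)"
  have nb: "nb E (pverts G) v = neighborhood G v" for v
    by (auto simp: nb_def E_def neighborhood_def dest: in_arcsD2)
  have sg: "sgraph E"
    using pair_sym_arcs pair_no_loops
    by unfold_locales (fastforce simp: E_def symmetric_def dest: symD)+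
  have "degree G v \<le> 4" if "v \<in> pverts G" for v
  proof -
    have "degree G v \<le> Max (degree G ` pverts G)"
      by (rule Max_ge) (use that pair_finite_verts in simp_all)
    then show ?thesis using assms(4) unfolding max_degree_def by (rule order_trans)
  qed
  then have "\<forall>v\<in>pverts G. card (nb E (pverts G) v) \<le> 4 \<and> card (nb E (pverts G) v) + 2 \<le> card (L v)"
    using L by (simp add: nb degree_eq_card_neighborhood)
  moreover have "\<not> tight_five_cycle E L (pverts G)"
  proof
    assume "tight_five_cycle E L (pverts G)"
    then obtain a b c d e where dist: "distinct [a, b, c, d, e]" and sub: "{a, b, c, d, e} \<subseteq> pverts G"
      and nbs: "neighborhood G a = {e, b}" "neighborhood G b = {a, c}" "neighborhood G c = {b, d}"
        "neighborhood G d = {c, e}" "neighborhood G e = {d, a}"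
      unfolding tight_five_cycle_def nb by (elim exE conjE)
    have "v \<in> {a, b, c, d, e}" if "u \<in> {a, b, c, d, e}" "(u, v) \<in> parcs G" for u v
    proof -
      have "v \<in> neighborhood G u" using that(2) by (simp add: neighborhood_def)
      then show ?thesis using that(1) nbs by auto
    qed
    \<comment> \<open>Connectedness makes the five-cycle component the whole graph, so excluding the
      one isomorphism type is enough.\<close>
    then have "{a, b, c, d, e} = pverts G"
      by (intro closed_set_eq_pverts[OF assms(1,2) sub]) auto
    then show False using iso_cycle_graph_5[OF assms(1) dist _ nbs] assms(5) by simp
  qed
  ultimately have "list_ok E L (pverts G)" using pair_finite_verts by (simp add: list_ok_def)
  moreover have "\<not> K4_minor E (pverts G)"
  proof
    assume "K4_minor E (pverts G)"
    then obtain B :: "nat \<Rightarrow> 'a set" where B: "\<forall>i<4. B i \<subseteq> pverts G \<and> conn E (B i)"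
      "\<forall>i<4. \<forall>j<4. i \<noteq> j \<longrightarrow> B i \<inter> B j = {} \<and> (\<exists>u\<in>B i. \<exists>v\<in>B j. E u v)"
      unfolding K4_minor_def by blast
    have "is_minor (complete_graph 4) G"
      unfolding is_minor_def
    proof (intro exI[of _ B] conjI ballI impI)
      show "connected (with_proj G \<restriction> B x)" if "x \<in> pverts (complete_graph 4)" for x
        using that B(1) by (intro connected_induce_if_conn[of E]) (auto simp: E_def complete_graph_def)
      show "case p of (x, y) \<Rightarrow> \<exists>u\<in>B x. \<exists>v\<in>B y. (u, v) \<in> parcs G" if "p \<in> parcs (complete_graph 4)" for p
        using that B(2) by (auto simp: E_def complete_graph_def)
    qed (use B in \<open>auto simp: complete_graph_def\<close>)
    then show False using assms(3) by blast
  qed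
  ultimately obtain \<phi> where \<phi>: "pcf_except E L (pverts G) {} \<phi>" using ex_pcf_coloring[OF sg] by blast
  have "proper_coloring G \<phi>"
    using \<phi> in_arcsD1 in_arcsD2 by (fastforce simp: proper_coloring_def pcf_except_def E_def)
  moreover have "\<exists>c. \<exists>!u. u \<in> neighborhood G v \<and> \<phi> u = c" if "v \<in> pverts G" "neighborhood G v \<noteq> {}" for v
  proof -
    have "has_unique_color (neighborhood G v) \<phi>" using \<phi> that by (auto simp: pcf_except_def nb)
    then show ?thesis by (auto simp: has_unique_color_def)
  qed
  ultimately show "\<exists>\<phi>. proper_conflict_free_coloring G \<phi> \<and> (\<forall>v\<in>pverts G. \<phi> v \<in> L v)"
    using \<phi> by (auto simp: proper_conflict_free_coloring_def pcf_except_def)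
qed

end
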